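(* Let $\varphi:(M^{m},g)\to (N^{m+1},h)$ be an isometric immersion of codimension one between Riemannian manifolds, with mean curvature vector $\eta=H\xi$, where $\xi$ is a (local) unit normal vector field along $\varphi$ and $H$ is the mean curvature function. Then $\varphi$ is biharmonic if and only if $$ \begin{cases} \Delta H-H |A|^{2}+H\,\mathrm{Ric}^N(\xi,\xi)=0,\\ 2A(\mathrm{grad}\,H) +\frac{m}{2}\, \mathrm{grad}\, (H^2) -2 H \,(\mathrm{Ric}^N(\xi))^{\top}=0, \end{cases} $$ where $\mathrm{Ric}^N : T_qN\to T_qN$ denotes the Ricci operator of the ambient space, defined by $\langle \mathrm{Ric}^N (Z), W\rangle=\mathrm{Ric}^N (Z, W)$, and $A$ is the shape operator of the hypersurface with respect to $\xi$.
   Context: All manifolds, maps and tensor fields are smooth. A map $\varphi:(M,g)\to(N,h)$ between Riemannian manifolds has tension field $\tau(\varphi)=\mathrm{Trace}_g\nabla d\varphi$. It is biharmonic if it is a critical point of the bienergy $E^2(\varphi,\Omega)=\frac12\int_\Omega|\tau(\varphi)|^2dx$ for every compact $\Omega\subset M$; equivalently, its bitension field $$\tau^2(\varphi)=\mathrm{Trace}_g(\nabla^\varphi\nabla^\varphi-\nabla^\varphi_{\nabla^M})\tau(\varphi)-\mathrm{Trace}_g R^N(d\varphi,\tau(\varphi))d\varphi$$ vanishes identically, where $R^N(X,Y)Z=[\nabla^N_X,\nabla^N_Y]Z-\nabla^N_{[X,Y]}Z$. For a codimension-one isometric immersion with local unit normal field $\xi$, tangent vectors of $M$ are identified with their images under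 $d\varphi$. The shape operator is determined by $\langle AX,Y\rangle=\langle\nabla^N_XY,\xi\rangle=-\langle Y,\nabla^N_X\xi\rangle=b(X,Y)$ for $X,Y$ tangent to $M$. The mean curvature function is $H=\frac1m\mathrm{trace}\,A$, and $|A|^2=\sum_{i,j}\langle Ae_i,e_j\rangle^2$ for a local orthonormal frame $\{e_i\}$ of $M$. $\mathrm{grad}$ and $\Delta=\mathrm{div}\,\mathrm{grad}$ are the gradient and the Laplace–Beltrami operator of $(M,g)$. $\mathrm{Ric}^N(\cdot,\cdot)$ is the Ricci tensor of $(N,h)$, and $(\cdot)^\top$ is the component tangent to $M$. *)

theory Defs
  imports "HOL-Analysis.Analysis"
begin

section \<open>Smooth functions on open subsets of Euclidean space\<close>

abbreviation Der :: "('v::real_normed_vector \<Rightarrow> 'w::real_normed_vector) \<Rightarrow> 'v \<Rightarrow> 'v \<Rightarrow> 'w" where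
  "Der f x \<equiv> frechet_derivative f (at x)"

text \<open>Only meaningful for open \<open>S\<close>: the derivatives are taken at \<open>x\<close> in the full space, and then
  depend only on the germ of \<open>f\<close> at \<open>x\<close>.\<close>

primrec Ck_on :: "nat \<Rightarrow> 'v::euclidean_space set \<Rightarrow> ('v \<Rightarrow> 'w::real_normed_vector) \<Rightarrow> bool" where
  "Ck_on 0 S f \<longleftrightarrow> continuous_on S f"
| "Ck_on (Suc k) S f \<longleftrightarrow> f differentiable_on S \<and> (\<forall>v. Ck_on k S (\<lambda>x. Der f x v))"

definition smooth_on :: "'v::euclidean_space set \<Rightarrow> ('v \<Rightarrow> 'w::real_normed_vector) \<Rightarrow> bool" where
  "smooth_on S f \<longleftrightarrow> (\<forall>k. Ck_on k S f)"


section \<open>Riemannian manifolds and isometric immersions\<close>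

text \<open>The underlying set of an \<open>m\<close>-dimensional manifold is a type \<open>'a\<close> carrying a Hausdorff, second
  countable topology; \<open>m = CARD('m)\<close>. A tensor field is given by its components in each chart of an
  atlas, subject to the usual transformation law. In particular a tangent vector at \<open>q\<close> is
  represented, in a chart around \<open>q\<close>, by its component vector with respect to the coordinate
  frame, and a metric by its matrix \<open>(g\<^sub>i\<^sub>j)\<close> as a function of the coordinates.\<close>

record ('a, 'm) chart =
  cdom :: "'a set"
  coord :: "'a \<Rightarrow> real ^ 'm"

definition chart_inv :: "('a, 'm::finite) chart \<Rightarrow> real ^ 'm \<Rightarrow> 'a" where
  "chart_inv c = inv_into (cdom c) (coord c)"

definition is_chart :: "('a::topological_space, 'm::finite) chart \<Rightarrow> bool" where
  "is_chart c \<longleftrightarrow> open (cdom c) \<and> open (coord c ` cdom c) \<and>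
     homeomorphism (cdom c) (coord c ` cdom c) (coord c) (chart_inv c)"

abbreviation transition :: "('a, 'm::finite) chart \<Rightarrow> ('a, 'm) chart \<Rightarrow> real ^ 'm \<Rightarrow> real ^ 'm" where
  "transition c c' \<equiv> coord c' \<circ> chart_inv c"

definition smooth_atlas ::
  "('a::{t2_space, second_countable_topology}, 'm::finite) chart set \<Rightarrow> bool" where
  "smooth_atlas \<A> \<longleftrightarrow> (\<Union>c\<in>\<A>. cdom c) = UNIV \<and> (\<forall>c\<in>\<A>. is_chart c) \<and>
     (\<forall>c\<in>\<A>. \<forall>c'\<in>\<A>. smooth_on (coord c ` (cdom c \<inter> cdom c')) (transition c c'))"

definition ip :: "(real ^ 'm \<Rightarrow> real ^ 'm ^ 'm) \<Rightarrow> real ^ 'm \<Rightarrow> real ^ 'm \<Rightarrow> real ^ 'm::finite \<Rightarrow> real" where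
  "ip g x u v = u \<bullet> (g x *v v)"

record ('a, 'm) rmanifold =
  atlas :: "('a, 'm) chart set"
  metric :: "('a, 'm) chart \<Rightarrow> real ^ 'm \<Rightarrow> real ^ 'm ^ 'm"

definition charts_at :: "('a, 'm::finite) rmanifold \<Rightarrow> 'a \<Rightarrow> ('a, 'm) chart set" where
  "charts_at M p = {c \<in> atlas M. p \<in> cdom c}"

definition riemannian_manifold ::
  "('a::{t2_space, second_countable_topology}, 'm::finite) rmanifold \<Rightarrow> bool" where
  "riemannian_manifold M \<longleftrightarrow> smooth_atlas (atlas M) \<and>
     (\<forall>c\<in>atlas M. smooth_on (coord c ` cdom c) (metric M c)) \<and>
     (\<forall>p. \<forall>c\<in>charts_at M p.
        (\<forall>u v. ip (metric M c) (coord c p) u v = ip (metric M c) (coord c p) v u) \<and>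
        (\<forall>u. u \<noteq> 0 \<longrightarrow> ip (metric M c) (coord c p) u u > 0) \<and>
        (\<forall>c'\<in>charts_at M p. \<forall>u v. ip (metric M c) (coord c p) u v =
           ip (metric M c') (coord c' p)
             (Der (transition c c') (coord c p) u) (Der (transition c c') (coord c p) v)))"

definition local_rep ::
  "('a \<Rightarrow> 'b) \<Rightarrow> ('a, 'm::finite) chart \<Rightarrow> ('b, 'n::finite) chart \<Rightarrow> real ^ 'm \<Rightarrow> real ^ 'n" where
  "local_rep \<phi> c d = coord d \<circ> \<phi> \<circ> chart_inv c"

definition smooth_map :: "('a::topological_space, 'm::finite) rmanifold \<Rightarrow>
    ('b::topological_space, 'n::finite) rmanifold \<Rightarrow> ('a \<Rightarrow> 'b) \<Rightarrow> bool" where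
  "smooth_map M N \<phi> \<longleftrightarrow> continuous_on UNIV \<phi> \<and>
     (\<forall>c\<in>atlas M. \<forall>d\<in>atlas N.
        smooth_on (coord c ` (cdom c \<inter> \<phi> -` cdom d)) (local_rep \<phi> c d))"

text \<open>Injectivity of the differential follows from positive definiteness of the metric of \<open>M\<close>.\<close>

definition isometric_immersion :: "('a::topological_space, 'm::finite) rmanifold \<Rightarrow>
    ('b::topological_space, 'n::finite) rmanifold \<Rightarrow> ('a \<Rightarrow> 'b) \<Rightarrow> bool" where
  "isometric_immersion M N \<phi> \<longleftrightarrow> smooth_map M N \<phi> \<and>
     (\<forall>p. \<forall>c\<in>charts_at M p. \<forall>d\<in>charts_at N (\<phi> p). \<forall>u v.
        ip (metric N d) (coord d (\<phi> p))
          (Der (local_rep \<phi> c d) (coord c p) u) (Der (local_rep \<phi> c d) (coord c p) v)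
        = ip (metric M c) (coord c p) u v)"

text \<open>A smooth unit normal field along \<open>\<phi>\<close> restricted to the open set \<open>U\<close>;
  \<open>\<xi> d p\<close> is the component vector of \<open>\<xi>\<^sub>p\<close>, an element of the tangent space of \<open>N\<close> at \<open>\<phi> p\<close>,
  in the chart \<open>d\<close> of \<open>N\<close>.\<close>

definition unit_normal_on :: "('a::topological_space, 'm::finite) rmanifold \<Rightarrow>
    ('b::topological_space, 'n::finite) rmanifold \<Rightarrow> ('a \<Rightarrow> 'b) \<Rightarrow> 'a set \<Rightarrow>
    (('b, 'n) chart \<Rightarrow> 'a \<Rightarrow> real ^ 'n) \<Rightarrow> bool" where
  "unit_normal_on M N \<phi> U \<xi> \<longleftrightarrow> open U \<and>
     (\<forall>c\<in>atlas M. \<forall>d\<in>atlas N.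
        smooth_on (coord c ` (U \<inter> cdom c \<inter> \<phi> -` cdom d)) (\<xi> d \<circ> chart_inv c)) \<and>
     (\<forall>p\<in>U. \<forall>d\<in>charts_at N (\<phi> p).
        (\<forall>d'\<in>charts_at N (\<phi> p). \<xi> d' p = Der (transition d d') (coord d (\<phi> p)) (\<xi> d p)) \<and>
        ip (metric N d) (coord d (\<phi> p)) (\<xi> d p) (\<xi> d p) = 1 \<and>
        (\<forall>c\<in>charts_at M p. \<forall>v.
           ip (metric N d) (coord d (\<phi> p)) (\<xi> d p) (Der (local_rep \<phi> c d) (coord c p) v) = 0))"


section \<open>Riemannian geometry in coordinates\<close>

text \<open>In this section \<open>g\<close> and \<open>h\<close> are coordinate matrices of metrics on open subsets of
  \<open>\<real>\<^sup>m\<close> and \<open>\<real>\<^sup>n\<close>, and \<open>F\<close> is a map between these sets. The Christoffel symbols are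
  \<open>\<Gamma>\<^sup>k\<^sub>i\<^sub>j = 1/2 (\<Sum>l. g\<^sup>k\<^sup>l (\<partial>\<^sub>i g\<^sub>j\<^sub>l + \<partial>\<^sub>j g\<^sub>i\<^sub>l - \<partial>\<^sub>l g\<^sub>i\<^sub>j))\<close>;
  \<open>christoffel g x u v\<close> is the vector \<open>(\<Sum>i j. \<Gamma>\<^sup>k\<^sub>i\<^sub>j(x) u\<^sup>i v\<^sup>j)\<^sub>k\<close>.\<close>

definition christoffel ::
  "(real ^ 'm \<Rightarrow> real ^ 'm ^ 'm) \<Rightarrow> real ^ 'm \<Rightarrow> real ^ 'm \<Rightarrow> real ^ 'm \<Rightarrow> real ^ 'm::finite" where
  "christoffel g x u v =
     (let dg = (\<lambda>i j l. Der (\<lambda>y. g y $ j $ l) x (axis i 1)) in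
      \<chi> k. \<Sum>i\<in>UNIV. \<Sum>j\<in>UNIV.
        (1 / 2 * (\<Sum>l\<in>UNIV. matrix_inv (g x) $ k $ l * (dg i j l + dg j i l - dg l i j))) * u $ i * v $ j)"

text \<open>The pull-back connection of the Levi-Civita connection of \<open>h\<close>: the covariant derivative at
  \<open>x\<close> in direction \<open>u\<close> of a vector field \<open>V\<close> along \<open>F\<close>.\<close>

definition covd :: "(real ^ 'n \<Rightarrow> real ^ 'n ^ 'n) \<Rightarrow> (real ^ 'm \<Rightarrow> real ^ 'n) \<Rightarrow>
    (real ^ 'm \<Rightarrow> real ^ 'n) \<Rightarrow> real ^ 'm \<Rightarrow> real ^ 'm::finite \<Rightarrow> real ^ 'n::finite" where
  "covd h F V x u = Der V x u + christoffel h (F x) (Der F x u) (V x)"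

definition nabla :: "(real ^ 'm \<Rightarrow> real ^ 'm ^ 'm) \<Rightarrow> (real ^ 'm \<Rightarrow> real ^ 'm) \<Rightarrow>
    (real ^ 'm \<Rightarrow> real ^ 'm) \<Rightarrow> real ^ 'm \<Rightarrow> real ^ 'm::finite" where
  "nabla g X Y x = covd g (\<lambda>y. y) Y x (X x)"

definition lie_bracket :: "(real ^ 'm \<Rightarrow> real ^ 'm) \<Rightarrow> (real ^ 'm \<Rightarrow> real ^ 'm) \<Rightarrow>
    real ^ 'm \<Rightarrow> real ^ 'm::finite" where
  "lie_bracket X Y x = Der Y x (X x) - Der X x (Y x)"

definition curvature_field :: "(real ^ 'm \<Rightarrow> real ^ 'm ^ 'm) \<Rightarrow> (real ^ 'm \<Rightarrow> real ^ 'm) \<Rightarrow>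
    (real ^ 'm \<Rightarrow> real ^ 'm) \<Rightarrow> (real ^ 'm \<Rightarrow> real ^ 'm) \<Rightarrow> real ^ 'm \<Rightarrow> real ^ 'm::finite" where
  "curvature_field g X Y Z x =
     nabla g X (nabla g Y Z) x - nabla g Y (nabla g X Z) x - nabla g (lie_bracket X Y) Z x"

text \<open>Tensors are evaluated at vectors by extending these to constant-coefficient vector fields.\<close>

definition curvature :: "(real ^ 'm \<Rightarrow> real ^ 'm ^ 'm) \<Rightarrow> real ^ 'm \<Rightarrow>
    real ^ 'm \<Rightarrow> real ^ 'm \<Rightarrow> real ^ 'm \<Rightarrow> real ^ 'm::finite" where
  "curvature g x u v w = curvature_field g (\<lambda>_. u) (\<lambda>_. v) (\<lambda>_. w) x"

text \<open>\<open>Ric(u,v) = Trace (w \<mapsto> R(w,u)v)\<close>, which is positive on round spheres.\<close>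

definition ricci ::
  "(real ^ 'm \<Rightarrow> real ^ 'm ^ 'm) \<Rightarrow> real ^ 'm \<Rightarrow> real ^ 'm \<Rightarrow> real ^ 'm::finite \<Rightarrow> real" where
  "ricci g x u v = trace (matrix (\<lambda>w. curvature g x w u v))"

text \<open>The vector that represents a linear form.\<close>

definition sharp :: "(real ^ 'm \<Rightarrow> real ^ 'm ^ 'm) \<Rightarrow> real ^ 'm \<Rightarrow> (real ^ 'm \<Rightarrow> real) \<Rightarrow>
    real ^ 'm::finite" where
  "sharp g x \<alpha> = (THE w. \<forall>v. ip g x w v = \<alpha> v)"

definition ricci_op ::
  "(real ^ 'm \<Rightarrow> real ^ 'm ^ 'm) \<Rightarrow> real ^ 'm \<Rightarrow> real ^ 'm \<Rightarrow> real ^ 'm::finite" where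
  "ricci_op g x u = sharp g x (ricci g x u)"

definition grad ::
  "(real ^ 'm \<Rightarrow> real ^ 'm ^ 'm) \<Rightarrow> (real ^ 'm \<Rightarrow> real) \<Rightarrow> real ^ 'm \<Rightarrow> real ^ 'm::finite" where
  "grad g f x = sharp g x (Der f x)"

definition divergence ::
  "(real ^ 'm \<Rightarrow> real ^ 'm ^ 'm) \<Rightarrow> (real ^ 'm \<Rightarrow> real ^ 'm) \<Rightarrow> real ^ 'm::finite \<Rightarrow> real" where
  "divergence g X x = trace (matrix (\<lambda>u. nabla g (\<lambda>_. u) X x))"

definition laplacian ::
  "(real ^ 'm \<Rightarrow> real ^ 'm ^ 'm) \<Rightarrow> (real ^ 'm \<Rightarrow> real) \<Rightarrow> real ^ 'm::finite \<Rightarrow> real" where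
  "laplacian g f x = divergence g (grad g f) x"

text \<open>The metric trace \<open>\<Sum>i j. g\<^sup>i\<^sup>j B(\<partial>\<^sub>i,\<partial>\<^sub>j)\<close> of a bilinear map.\<close>

definition trace_g :: "(real ^ 'm \<Rightarrow> real ^ 'm ^ 'm) \<Rightarrow> real ^ 'm \<Rightarrow>
    (real ^ 'm \<Rightarrow> real ^ 'm::finite \<Rightarrow> 'w::real_vector) \<Rightarrow> 'w" where
  "trace_g g x B = (\<Sum>i\<in>UNIV. \<Sum>j\<in>UNIV. (matrix_inv (g x) $ i $ j) *\<^sub>R B (axis i 1) (axis j 1))"


subsection \<open>Tension and bitension field\<close>

definition nabla_dF :: "(real ^ 'm \<Rightarrow> real ^ 'm ^ 'm) \<Rightarrow> (real ^ 'n \<Rightarrow> real ^ 'n ^ 'n) \<Rightarrow>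
    (real ^ 'm \<Rightarrow> real ^ 'n) \<Rightarrow> real ^ 'm \<Rightarrow> real ^ 'm \<Rightarrow> real ^ 'm::finite \<Rightarrow> real ^ 'n::finite" where
  "nabla_dF g h F x u v =
     covd h F (\<lambda>y. Der F y v) x u - Der F x (nabla g (\<lambda>_. u) (\<lambda>_. v) x)"

definition tension :: "(real ^ 'm \<Rightarrow> real ^ 'm ^ 'm) \<Rightarrow> (real ^ 'n \<Rightarrow> real ^ 'n ^ 'n) \<Rightarrow>
    (real ^ 'm \<Rightarrow> real ^ 'n) \<Rightarrow> real ^ 'm::finite \<Rightarrow> real ^ 'n::finite" where
  "tension g h F x = trace_g g x (nabla_dF g h F x)"

definition bitension :: "(real ^ 'm \<Rightarrow> real ^ 'm ^ 'm) \<Rightarrow> (real ^ 'n \<Rightarrow> real ^ 'n ^ 'n) \<Rightarrow>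
    (real ^ 'm \<Rightarrow> real ^ 'n) \<Rightarrow> real ^ 'm::finite \<Rightarrow> real ^ 'n::finite" where
  "bitension g h F x =
     trace_g g x (\<lambda>u v. covd h F (\<lambda>y. covd h F (tension g h F) y v) x u
                        - covd h F (tension g h F) x (nabla g (\<lambda>_. u) (\<lambda>_. v) x))
     - trace_g g x (\<lambda>u v. curvature h (F x) (Der F x u) (tension g h F x) (Der F x v))"

definition biharmonic :: "('a, 'm::finite) rmanifold \<Rightarrow> ('b, 'n::finite) rmanifold \<Rightarrow>
    ('a \<Rightarrow> 'b) \<Rightarrow> bool" where
  "biharmonic M N \<phi> \<longleftrightarrow> (\<forall>p. \<forall>c\<in>charts_at M p. \<forall>d\<in>charts_at N (\<phi> p).
     bitension (metric M c) (metric N d) (local_rep \<phi> c d) (coord c p) = 0)"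


subsection \<open>Hypersurfaces\<close>

text \<open>Here \<open>F\<close> is the coordinate representation of an isometric immersion of codimension one, and
  \<open>\<nu>\<close> that of a unit normal field along it.\<close>

definition second_form :: "(real ^ 'n \<Rightarrow> real ^ 'n ^ 'n) \<Rightarrow> (real ^ 'm \<Rightarrow> real ^ 'n) \<Rightarrow>
    (real ^ 'm \<Rightarrow> real ^ 'n::finite) \<Rightarrow> real ^ 'm \<Rightarrow> real ^ 'm \<Rightarrow> real ^ 'm::finite \<Rightarrow> real" where
  "second_form h F \<nu> x u v = ip h (F x) (covd h F (\<lambda>y. Der F y v) x u) (\<nu> x)"

definition shape_op :: "(real ^ 'm \<Rightarrow> real ^ 'm ^ 'm) \<Rightarrow> (real ^ 'n \<Rightarrow> real ^ 'n ^ 'n) \<Rightarrow>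
    (real ^ 'm \<Rightarrow> real ^ 'n) \<Rightarrow> (real ^ 'm \<Rightarrow> real ^ 'n::finite) \<Rightarrow>
    real ^ 'm \<Rightarrow> real ^ 'm \<Rightarrow> real ^ 'm::finite" where
  "shape_op g h F \<nu> x u = sharp g x (second_form h F \<nu> x u)"

definition mean_curvature :: "(real ^ 'm \<Rightarrow> real ^ 'm ^ 'm) \<Rightarrow> (real ^ 'n \<Rightarrow> real ^ 'n ^ 'n) \<Rightarrow>
    (real ^ 'm \<Rightarrow> real ^ 'n) \<Rightarrow> (real ^ 'm \<Rightarrow> real ^ 'n::finite) \<Rightarrow> real ^ 'm::finite \<Rightarrow> real" where
  "mean_curvature g h F \<nu> x = 1 / real CARD('m) * trace (matrix (shape_op g h F \<nu> x))"

definition orthonormal_frame ::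
  "(real ^ 'm \<Rightarrow> real ^ 'm ^ 'm) \<Rightarrow> real ^ 'm \<Rightarrow> ('m \<Rightarrow> real ^ 'm::finite) \<Rightarrow> bool" where
  "orthonormal_frame g x e \<longleftrightarrow> (\<forall>i j. ip g x (e i) (e j) = (if i = j then 1 else 0))"

definition shape_norm_sq :: "(real ^ 'm \<Rightarrow> real ^ 'm ^ 'm) \<Rightarrow> (real ^ 'n \<Rightarrow> real ^ 'n ^ 'n) \<Rightarrow>
    (real ^ 'm \<Rightarrow> real ^ 'n) \<Rightarrow> (real ^ 'm \<Rightarrow> real ^ 'n::finite) \<Rightarrow> real ^ 'm::finite \<Rightarrow> real" where
  "shape_norm_sq g h F \<nu> x =
     (let e = (SOME e. orthonormal_frame g x e)
      in \<Sum>i\<in>UNIV. \<Sum>j\<in>UNIV. (ip g x (shape_op g h F \<nu> x (e i)) (e j))\<^sup>2)"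

text \<open>The tangent vector \<open>w\<close> of the hypersurface for which \<open>W - dF(w)\<close> is normal.\<close>

definition tangential :: "(real ^ 'n \<Rightarrow> real ^ 'n ^ 'n) \<Rightarrow> (real ^ 'm \<Rightarrow> real ^ 'n) \<Rightarrow>
    real ^ 'm \<Rightarrow> real ^ 'n::finite \<Rightarrow> real ^ 'm::finite" where
  "tangential h F x W = (THE w. \<forall>v. ip h (F x) (W - Der F x w) (Der F x v) = 0)"

definition hypersurface_equations :: "(real ^ 'm \<Rightarrow> real ^ 'm ^ 'm) \<Rightarrow>
    (real ^ 'n \<Rightarrow> real ^ 'n ^ 'n) \<Rightarrow> (real ^ 'm \<Rightarrow> real ^ 'n) \<Rightarrow>
    (real ^ 'm \<Rightarrow> real ^ 'n::finite) \<Rightarrow> real ^ 'm::finite \<Rightarrow> bool" where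
  "hypersurface_equations g h F \<nu> x \<longleftrightarrow>
     (let H = mean_curvature g h F \<nu>; A = shape_op g h F \<nu> x in
        laplacian g H x - H x * shape_norm_sq g h F \<nu> x
          + H x * ricci h (F x) (\<nu> x) (\<nu> x) = 0 \<and>
        2 *\<^sub>R A (grad g H x) + (real CARD('m) / 2) *\<^sub>R grad g (\<lambda>y. (H y)\<^sup>2) x
          - (2 * H x) *\<^sub>R tangential h F x (ricci_op h (F x) (\<nu> x)) = 0)"

definition hypersurface_equations_on :: "('a, 'm::finite) rmanifold \<Rightarrow>
    ('b, 'n::finite) rmanifold \<Rightarrow> ('a \<Rightarrow> 'b) \<Rightarrow> 'a set \<Rightarrow>
    (('b, 'n) chart \<Rightarrow> 'a \<Rightarrow> real ^ 'n) \<Rightarrow> bool" where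
  "hypersurface_equations_on M N \<phi> U \<xi> \<longleftrightarrow>
     (\<forall>p\<in>U. \<forall>c\<in>charts_at M p. \<forall>d\<in>charts_at N (\<phi> p).
        hypersurface_equations (metric M c) (metric N d) (local_rep \<phi> c d)
          (\<xi> d \<circ> chart_inv c) (coord c p))"

end

theory Submission
  imports Defs
begin

text \<open>
  The tension field of the immersion is \<open>m H \<xi>\<close>. Expanding the covariant derivatives of this product
  with the Leibniz rule, the rough Laplacian of \<open>\<tau>\<close> becomes
  \<open>m (\<Delta>H \<xi> + 2 \<nabla>\<^bsub>grad H\<^esub> \<xi> + H \<Delta>\<xi>)\<close>. By Weingarten's formula \<open>\<nabla>\<^bsub>grad H\<^esub> \<xi> = - A(grad H)\<close>; the normal
  component of \<open>\<Delta>\<xi>\<close> is \<open>- |A|\<^sup>2\<close>, and by Codazzi's equation its tangential component is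
  \<open>- m grad H + (Ric\<^sup>N \<xi>)\<^sup>T\<close>. The curvature term of the bitension field contributes \<open>Ric\<^sup>N(\<xi>)\<close> once more, as \<open>m H Ric\<^sup>N(\<xi>)\<close>.
  Everything is computed in a pair of charts, where \<open>\<nabla>\<close> along the immersion is \<open>covd\<close>. Local unit
  normal fields exist because the normal component of a constant vector that is not tangent at a
  point stays nonzero nearby.
\<close>

section \<open>Calculus of smooth functions\<close>

text \<open>Frames are orthonormal only at the point considered, and their vectors are extended with
  constant coefficients in the chart. No frame is ever differentiated; instead the Hessian of
  \<open>H\<close>, \<open>Db\<close> and the second derivative of the normal each carry explicit
  Christoffel corrections. The equivalence is pointwise in every pair of charts: the bitension
  vector is paired with the normal, which gives the first equation, and with the images of tangent
  vectors, which gives the second, each up to a nonzero multiple of m. Since the bitension field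
  does not refer to a normal, one normal field near a point decides about that point; hence the
  formulations with all local normals and with some normal near each point agree. The obstacle of
  the coordinate setting is regularity: vectors defined by a definite description, such as
  \<open>sharp\<close>, have to be differentiated, and their smoothness goes back to Cramer's rule
  for the inverse metric.\<close>

lemma Der_eqI: "(f has_derivative f') (at x) \<Longrightarrow> Der f x = f'"
  by (rule frechet_derivative_at[symmetric])

lemma differentiable_has_Der:
  "f differentiable (at x) \<Longrightarrow> (f has_derivative Der f x) (at x)"
  by (simp add: frechet_derivative_works)

lemma linear_Der: "f differentiable (at x) \<Longrightarrow> linear (Der f x)"
  by (rule has_derivative_linear[OF differentiable_has_Der])

text \<open>\<open>frechet_derivative\<close> is a choice among the maps satisfying
  \<open>has_derivative\<close>. Functions that agree near \<open>x\<close> satisfy it for the same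
  maps, so the choices coincide even where no derivative exists. Identities valid only on an open
  set can thus be differentiated.\<close>

lemma Der_cong_open:
  assumes "open S" "x \<in> S" "\<And>y. y \<in> S \<Longrightarrow> f y = g y"
  shows "Der f x = Der g x"
proof -
  have "(f has_derivative D) (at x) \<longleftrightarrow> (g has_derivative D) (at x)" for D
    using has_derivative_transform_within_open[OF _ assms(1,2), of f D UNIV g]
      has_derivative_transform_within_open[OF _ assms(1,2), of g D UNIV f] assms(3) by auto
  then show ?thesis by (simp add: frechet_derivative_def)
qed

lemma differentiable_on_transform:
  assumes "f differentiable_on S" "\<And>x. x \<in> S \<Longrightarrow> g x = f x"
  shows "g differentiable_on S"
  unfolding differentiable_on_def
proof
  fix x assume "x \<in> S"
  moreover obtain D where "(f has_derivative D) (at x within S)"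
    using assms(1) \<open>x \<in> S\<close> unfolding differentiable_on_def differentiable_def by blast
  ultimately have "(g has_derivative D) (at x within S)"
    using has_derivative_transform assms(2) by blast
  then show "g differentiable (at x within S)" by (auto simp: differentiable_def)
qed

lemma Ck_on_cong:
  assumes "open S" "\<And>x. x \<in> S \<Longrightarrow> f x = g x"
  shows "Ck_on k S f \<longleftrightarrow> Ck_on k S g"
  using assms(2)
proof (induction k arbitrary: f g)
  case 0
  then show ?case by (simp cong: continuous_on_cong)
next
  case (Suc k)
  have "Ck_on k S (\<lambda>x. Der f x v) \<longleftrightarrow> Ck_on k S (\<lambda>x. Der g x v)" for v
    by (rule Suc.IH) (rule fun_cong[OF Der_cong_open[OF assms(1)]], use Suc.prems in auto)
  moreover have "f differentiable_on S \<longleftrightarrow> g differentiable_on S"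
    using Suc.prems differentiable_on_transform[of f S g] differentiable_on_transform[of g S f] by auto
  ultimately show ?case by simp
qed

lemma Ck_on_subset:
  assumes "Ck_on k S f" "T \<subseteq> S"
  shows "Ck_on k T f"
  using assms
proof (induction k arbitrary: f)
  case 0
  then show ?case using continuous_on_subset by auto
next
  case (Suc k)
  then show ?case using differentiable_on_subset by auto
qed

lemma Ck_on_Suc: "Ck_on (Suc k) S f \<Longrightarrow> Ck_on k S f"
proof (induction k arbitrary: f)
  case 0
  then show ?case by (simp add: differentiable_imp_continuous_on)
next
  case (Suc k)
  then show ?case by (metis Ck_on.simps(2))
qed

lemma differentiable_on_openD:
  "f differentiable_on S \<Longrightarrow> open S \<Longrightarrow> x \<in> S \<Longrightarrow> f differentiable (at x)"
  by (metis at_within_open differentiable_on_def)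

section \<open>Closure of C^k functions under sums, products, composition, inverse and square
  root\<close>

lemma Ck_on_const: "Ck_on k S (\<lambda>_. c)"
  by (induction k arbitrary: c) auto

lemma Ck_on_add:
  assumes "open S" "Ck_on k S f" "Ck_on k S g"
  shows "Ck_on k S (\<lambda>x. f x + g x)"
  using assms(2,3)
proof (induction k arbitrary: f g)
  case 0
  then show ?case by (simp add: continuous_on_add)
next
  case (Suc k)
  have "Der (\<lambda>x. f x + g x) x v = Der f x v + Der g x v" if "x \<in> S" for x v
    by (rule fun_cong[OF Der_eqI])
      (use that Suc.prems assms(1) in \<open>auto intro!: has_derivative_add differentiable_has_Der
        intro: differentiable_on_openD\<close>)
  then have "Ck_on k S (\<lambda>x. Der (\<lambda>x. f x + g x) x v)" for v
    by (subst Ck_on_cong[OF assms(1)]) (use Suc in auto)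
  moreover have "(\<lambda>x. f x + g x) differentiable_on S"
    using Suc.prems by (auto intro: differentiable_on_add)
  ultimately show ?case by simp
qed

lemma Ck_on_sum:
  assumes "open S" "\<And>i. i \<in> I \<Longrightarrow> Ck_on k S (f i)"
  shows "Ck_on k S (\<lambda>x. \<Sum>i\<in>I. f i x)"
  using assms(2)
  by (induction I rule: infinite_finite_induct) (auto intro: Ck_on_const Ck_on_add[OF assms(1)])

text \<open>The product rule yields two terms of the same bilinear shape in which one factor is a
  directional derivative; hence the induction with both factors arbitrary.\<close>

lemma Ck_on_bilinear:
  assumes B: "bounded_bilinear B" and "open S" "Ck_on k S f" "Ck_on k S g"
  shows "Ck_on k S (\<lambda>x. B (f x) (g x))"
  using assms(3,4)
proof (induction k arbitrary: f g)
  case 0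
  then show ?case by (simp add: bounded_bilinear.continuous_on[OF B])
next
  case (Suc k)
  have D: "((\<lambda>x. B (f x) (g x)) has_derivative (\<lambda>v. B (f x) (Der g x v) + B (Der f x v) (g x))) (at x)"
    if "x \<in> S" for x
    by (rule bounded_bilinear.FDERIV[OF B])
      (use that Suc.prems assms(2) in \<open>auto intro!: differentiable_has_Der intro: differentiable_on_openD\<close>)
  have "Ck_on k S (\<lambda>x. B (f x) (Der g x v) + B (Der f x v) (g x))" for v
    using Suc.prems Suc.prems[THEN Ck_on_Suc] by (intro Ck_on_add Suc.IH assms(2)) auto
  then have "Ck_on k S (\<lambda>x. Der (\<lambda>x. B (f x) (g x)) x v)" for v
    by (subst Ck_on_cong[OF assms(2)]) (auto simp: Der_eqI[OF D])
  moreover have "(\<lambda>x. B (f x) (g x)) differentiable_on S"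
    unfolding differentiable_on_def differentiable_def
    using D has_derivative_at_withinI by blast
  ultimately show ?case by simp
qed

lemma Ck_on_linear:
  assumes L: "bounded_linear L" and "open S" "Ck_on k S f"
  shows "Ck_on k S (\<lambda>x. L (f x))"
  using assms(3)
proof (induction k arbitrary: f)
  case 0
  then show ?case by (simp add: bounded_linear.continuous_on[OF L])
next
  case (Suc k)
  have D: "((\<lambda>x. L (f x)) has_derivative (\<lambda>v. L (Der f x v))) (at x)" if "x \<in> S" for x
    by (rule bounded_linear.has_derivative[OF L])
      (use that Suc.prems assms(2) in \<open>auto intro!: differentiable_has_Der intro: differentiable_on_openD\<close>)
  have "Ck_on k S (\<lambda>x. L (Der f x v))" for v
    using Suc by auto
  then have "Ck_on k S (\<lambda>x. Der (\<lambda>x. L (f x)) x v)" for v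
    by (subst Ck_on_cong[OF assms(2)]) (auto simp: Der_eqI[OF D])
  moreover have "(\<lambda>x. L (f x)) differentiable_on S"
    unfolding differentiable_on_def differentiable_def
    using D has_derivative_at_withinI by blast
  ultimately show ?case by simp
qed

lemma linear_Basis_expand:
  fixes v :: "'a::euclidean_space"
  assumes "linear L"
  shows "L v = (\<Sum>b\<in>Basis. (v \<bullet> b) *\<^sub>R L b)"
proof -
  have "L v = L (\<Sum>b\<in>Basis. (v \<bullet> b) *\<^sub>R b)" by (simp add: euclidean_representation)
  also have "\<dots> = (\<Sum>b\<in>Basis. (v \<bullet> b) *\<^sub>R L b)"
    by (simp add: linear_sum[OF assms] linear_scale[OF assms])
  finally show ?thesis .
qed

text \<open>\<open>Ck_on\<close> controls \<open>Der f\<close> only in fixed directions, while the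
  chain rule applies it in the moving direction \<open>Der g x v\<close>. Expanding this direction
  in \<open>Basis\<close> leaves scalar coefficients times derivatives of \<open>f\<close> in fixed
  directions, to which the induction hypothesis applies.\<close>

lemma Ck_on_compose:
  fixes f :: "'v::euclidean_space \<Rightarrow> 'w::real_normed_vector" and g :: "'u::euclidean_space \<Rightarrow> 'v"
  assumes "open S" "open T" "g ` S \<subseteq> T" "Ck_on k T f" "Ck_on k S g"
  shows "Ck_on k S (\<lambda>x. f (g x))"
  using assms(4,5)
proof (induction k arbitrary: f)
  case 0
  then show ?case using assms(3) by (auto intro: continuous_on_compose2)
next
  case (Suc k)
  have df: "f differentiable (at (g x))" and dg: "g differentiable (at x)" if "x \<in> S" for x
    using that Suc.prems assms by (auto intro: differentiable_on_openD)
  have D: "((\<lambda>x. f (g x)) has_derivative (\<lambda>v. \<Sum>b\<in>Basis. (Der g x v \<bullet> b) *\<^sub>R Der f (g x) b)) (at x)"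
    if x: "x \<in> S" for x
  proof -
    have "((\<lambda>x. f (g x)) has_derivative (\<lambda>v. Der f (g x) (Der g x v))) (at x)"
      using has_derivative_compose[OF differentiable_has_Der[OF dg[OF x]] differentiable_has_Der[OF df[OF x]]] .
    moreover have "Der f (g x) (Der g x v) = (\<Sum>b\<in>Basis. (Der g x v \<bullet> b) *\<^sub>R Der f (g x) b)" for v
      by (rule linear_Basis_expand[OF linear_Der[OF df[OF x]]])
    ultimately show ?thesis by simp
  qed
  have "Ck_on k S (\<lambda>x. (Der g x v \<bullet> b) *\<^sub>R Der f (g x) b)" for v b
    using Suc.prems Ck_on_Suc[OF Suc.prems(2)]
    by (intro Ck_on_bilinear[OF bounded_bilinear_scaleR] Ck_on_bilinear[OF bounded_bilinear_inner]
        Ck_on_const Suc.IH assms(1)) auto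
  then have "Ck_on k S (\<lambda>x. \<Sum>b\<in>Basis. (Der g x v \<bullet> b) *\<^sub>R Der f (g x) b)" for v
    by (intro Ck_on_sum assms(1))
  then have "Ck_on k S (\<lambda>x. Der (\<lambda>x. f (g x)) x v)" for v
    by (subst Ck_on_cong[OF assms(1)]) (auto simp: Der_eqI[OF D])
  moreover have "(\<lambda>x. f (g x)) differentiable_on S"
    unfolding differentiable_on_def differentiable_def
    using D has_derivative_at_withinI by blast
  ultimately show ?case by simp
qed

text \<open>The derivative contains the inverse itself, so the induction keeps \<open>f\<close>
  fixed and feeds the result of order k back into the formula. \<open>Ck_on_sqrt\<close> proceeds
  likewise, with the inverse of the root.\<close>

lemma Ck_on_inverse:
  fixes f :: "'v::euclidean_space \<Rightarrow> real"
  assumes "open S" "Ck_on k S f" "\<And>x. x \<in> S \<Longrightarrow> f x \<noteq> 0"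
  shows "Ck_on k S (\<lambda>x. inverse (f x))"
  using assms(2)
proof (induction k)
  case 0
  then show ?case using assms(3) by (auto intro: continuous_on_inverse)
next
  case (Suc k)
  have D: "((\<lambda>x. inverse (f x)) has_derivative (\<lambda>v. - (inverse (f x) * Der f x v * inverse (f x)))) (at x)"
    if "x \<in> S" for x
    by (rule Deriv.has_derivative_inverse)
      (use that Suc.prems assms in \<open>auto intro!: differentiable_has_Der intro: differentiable_on_openD\<close>)
  have "Ck_on k S (\<lambda>x. - (inverse (f x) * Der f x v * inverse (f x)))" for v
    using Suc Ck_on_Suc[OF Suc.prems]
    by (intro Ck_on_linear[OF bounded_linear_minus[OF bounded_linear_ident]]
        Ck_on_bilinear[OF bounded_bilinear_mult] assms) auto
  then have "Ck_on k S (\<lambda>x. Der (\<lambda>x. inverse (f x)) x v)" for v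
    by (subst Ck_on_cong[OF assms(1)]) (auto simp: Der_eqI[OF D])
  moreover have "(\<lambda>x. inverse (f x)) differentiable_on S"
    unfolding differentiable_on_def differentiable_def
    using D has_derivative_at_withinI by blast
  ultimately show ?case by simp
qed

lemma Ck_on_sqrt:
  fixes f :: "'v::euclidean_space \<Rightarrow> real"
  assumes "open S" "Ck_on k S f" "\<And>x. x \<in> S \<Longrightarrow> f x > 0"
  shows "Ck_on k S (\<lambda>x. sqrt (f x))"
  using assms(2)
proof (induction k)
  case 0
  then show ?case by (auto intro: continuous_on_real_sqrt)
next
  case (Suc k)
  have D: "((\<lambda>x. sqrt (f x)) has_derivative (\<lambda>v. Der f x v * (inverse (sqrt (f x)) * (1 / 2)))) (at x)"
    if "x \<in> S" for x
    using has_derivative_real_sqrt[OF assms(3)[OF that] differentiable_has_Der[of f x]]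
      that Suc.prems assms by (auto intro: differentiable_on_openD)
  have "Ck_on k S (\<lambda>x. Der f x v * (inverse (sqrt (f x)) * (1 / 2)))" for v
    using Suc Ck_on_Suc[OF Suc.prems] assms(3)
    by (intro Ck_on_bilinear[OF bounded_bilinear_mult] Ck_on_inverse Ck_on_const assms(1)) force+
  then have "Ck_on k S (\<lambda>x. Der (\<lambda>x. sqrt (f x)) x v)" for v
    by (subst Ck_on_cong[OF assms(1)]) (auto simp: Der_eqI[OF D])
  moreover have "(\<lambda>x. sqrt (f x)) differentiable_on S"
    unfolding differentiable_on_def differentiable_def
    using D has_derivative_at_withinI by blast
  ultimately show ?case by simp
qed

lemma Ck_on_ident: "open S \<Longrightarrow> Ck_on k S (\<lambda>x. x)"
  by (cases k) (auto intro: Ck_on_const continuous_on_id simp: differentiable_on_def)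

section \<open>Closure properties of smooth functions\<close>

lemma smooth_on_subset: "smooth_on S f \<Longrightarrow> T \<subseteq> S \<Longrightarrow> smooth_on T f"
  unfolding smooth_on_def by (blast intro: Ck_on_subset)

lemma smooth_on_cong:
  "open S \<Longrightarrow> (\<And>x. x \<in> S \<Longrightarrow> f x = g x) \<Longrightarrow> smooth_on S f \<longleftrightarrow> smooth_on S g"
  unfolding smooth_on_def by (simp cong: Ck_on_cong)

lemma smooth_on_transform:
  assumes "smooth_on S g" "open S" "\<And>x. x \<in> S \<Longrightarrow> f x = g x"
  shows "smooth_on S f"
  using smooth_on_cong[OF assms(2), of f g] assms(1,3) by simp

lemma smooth_on_const: "smooth_on S (\<lambda>_. c)"
  by (simp add: smooth_on_def Ck_on_const)

lemma smooth_on_ident: "open S \<Longrightarrow> smooth_on S (\<lambda>x. x)"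
  by (simp add: smooth_on_def Ck_on_ident)

lemma smooth_on_add:
  "open S \<Longrightarrow> smooth_on S f \<Longrightarrow> smooth_on S g \<Longrightarrow> smooth_on S (\<lambda>x. f x + g x)"
  by (simp add: smooth_on_def Ck_on_add)

lemma smooth_on_sum:
  "open S \<Longrightarrow> (\<And>i. i \<in> I \<Longrightarrow> smooth_on S (f i)) \<Longrightarrow> smooth_on S (\<lambda>x. \<Sum>i\<in>I. f i x)"
  by (simp add: smooth_on_def Ck_on_sum)

lemma smooth_on_bilinear:
  "bounded_bilinear B \<Longrightarrow> open S \<Longrightarrow> smooth_on S f \<Longrightarrow> smooth_on S g \<Longrightarrow> smooth_on S (\<lambda>x. B (f x) (g x))"
  by (simp add: smooth_on_def Ck_on_bilinear)

lemmas smooth_on_scaleR = smooth_on_bilinear[OF bounded_bilinear_scaleR]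
lemmas smooth_on_mult = smooth_on_bilinear[OF bounded_bilinear_mult]
lemmas smooth_on_inner = smooth_on_bilinear[OF bounded_bilinear_inner]

lemma smooth_on_linear:
  "bounded_linear L \<Longrightarrow> open S \<Longrightarrow> smooth_on S f \<Longrightarrow> smooth_on S (\<lambda>x. L (f x))"
  by (simp add: smooth_on_def Ck_on_linear)

lemmas smooth_on_minus = smooth_on_linear[OF bounded_linear_minus[OF bounded_linear_ident]]
lemmas smooth_on_nth = smooth_on_linear[OF bounded_linear_vec_nth]

lemma smooth_on_diff:
  assumes "open S" "smooth_on S f" "smooth_on S g"
  shows "smooth_on S (\<lambda>x. f x - g x)"
  using smooth_on_add[OF assms(1,2) smooth_on_minus[OF assms(1,3)]] by simp

lemma smooth_on_prod:
  fixes f :: "'i \<Rightarrow> 'v::euclidean_space \<Rightarrow> real"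
  assumes "open S" "\<And>i. i \<in> I \<Longrightarrow> smooth_on S (f i)"
  shows "smooth_on S (\<lambda>x. \<Prod>i\<in>I. f i x)"
  using assms(2)
proof (induction I rule: infinite_finite_induct)
  case (insert i I)
  then show ?case
    using smooth_on_mult[OF assms(1), of "f i" "\<lambda>x. \<Prod>i\<in>I. f i x"] by simp
qed (simp_all add: smooth_on_const)

lemma smooth_on_inverse:
  fixes f :: "'v::euclidean_space \<Rightarrow> real"
  shows "open S \<Longrightarrow> smooth_on S f \<Longrightarrow> (\<And>x. x \<in> S \<Longrightarrow> f x \<noteq> 0) \<Longrightarrow> smooth_on S (\<lambda>x. inverse (f x))"
  by (simp add: smooth_on_def Ck_on_inverse)

lemma smooth_on_sqrt:
  fixes f :: "'v::euclidean_space \<Rightarrow> real"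
  shows "open S \<Longrightarrow> smooth_on S f \<Longrightarrow> (\<And>x. x \<in> S \<Longrightarrow> f x > 0) \<Longrightarrow> smooth_on S (\<lambda>x. sqrt (f x))"
  by (simp add: smooth_on_def Ck_on_sqrt)

lemma smooth_on_compose:
  "open S \<Longrightarrow> open T \<Longrightarrow> g ` S \<subseteq> T \<Longrightarrow> smooth_on T f \<Longrightarrow> smooth_on S g \<Longrightarrow> smooth_on S (\<lambda>x. f (g x))"
  by (simp add: smooth_on_def Ck_on_compose)

lemma smooth_on_Der: "smooth_on S f \<Longrightarrow> smooth_on S (\<lambda>x. Der f x v)"
  unfolding smooth_on_def
proof
  fix k
  assume "\<forall>k. Ck_on k S f"
  then have "Ck_on (Suc k) S f" by blast
  then show "Ck_on k S (\<lambda>x. Der f x v)" by simp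
qed

lemma smooth_on_differentiable:
  "smooth_on S f \<Longrightarrow> open S \<Longrightarrow> x \<in> S \<Longrightarrow> f differentiable (at x)"
  unfolding smooth_on_def using Ck_on.simps(2)[of 0 S f] by (blast intro: differentiable_on_openD)

lemma smooth_on_has_Der:
  "smooth_on S f \<Longrightarrow> open S \<Longrightarrow> x \<in> S \<Longrightarrow> (f has_derivative Der f x) (at x)"
  by (simp add: smooth_on_differentiable differentiable_has_Der)

lemma smooth_on_linear_Der: "smooth_on S f \<Longrightarrow> open S \<Longrightarrow> x \<in> S \<Longrightarrow> linear (Der f x)"
  by (simp add: smooth_on_differentiable linear_Der)

lemma smooth_on_continuous: "smooth_on S f \<Longrightarrow> continuous_on S f"
  unfolding smooth_on_def using Ck_on.simps(1)[of S f] by blast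

lemma smooth_on_vec:
  fixes f :: "'v::euclidean_space \<Rightarrow> real ^ 'n"
  assumes "open S" "\<And>i. smooth_on S (\<lambda>x. f x $ i)"
  shows "smooth_on S f"
proof -
  have "smooth_on S (\<lambda>x. \<Sum>i\<in>UNIV. f x $ i *\<^sub>R (axis i 1 :: real ^ 'n))"
    by (intro smooth_on_sum smooth_on_scaleR smooth_on_const assms)
  moreover have "(\<Sum>i\<in>UNIV. f x $ i *\<^sub>R axis i 1) = f x" for x
    by (metis basis_expansion scalar_mult_eq_scaleR)
  ultimately show ?thesis by simp
qed

section \<open>Symmetry of second derivatives\<close>

lemma mvt_line:
  fixes f :: "'v::real_normed_vector \<Rightarrow> real"
  assumes t: "t > 0" and d: "\<And>s. 0 \<le> s \<Longrightarrow> s \<le> t \<Longrightarrow> f differentiable (at (x + s *\<^sub>R u))"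
  shows "\<exists>s. 0 < s \<and> s < t \<and> f (x + t *\<^sub>R u) - f x = t * Der f (x + s *\<^sub>R u) u"
proof -
  have D: "((\<lambda>s. f (x + s *\<^sub>R u)) has_derivative (\<lambda>r. Der f (x + s *\<^sub>R u) (r *\<^sub>R u))) (at s)"
    if "0 \<le> s" "s \<le> t" for s
  proof -
    have "((\<lambda>s. x + s *\<^sub>R u) has_derivative (\<lambda>r. r *\<^sub>R u)) (at s)"
      by (auto intro!: derivative_eq_intros)
    from has_derivative_compose[OF this differentiable_has_Der[OF d[OF that]]] show ?thesis .
  qed
  obtain s where s: "s \<in> {0<..<t}"
    and e: "f (x + t *\<^sub>R u) - f (x + 0 *\<^sub>R u) = Der f (x + s *\<^sub>R u) ((t - 0) *\<^sub>R u)"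
    using mvt_simple[OF t, of "\<lambda>s. f (x + s *\<^sub>R u)" "\<lambda>s r. Der f (x + s *\<^sub>R u) (r *\<^sub>R u)"]
      D has_derivative_at_withinI by force
  have "linear (Der f (x + s *\<^sub>R u))"
    using s by (intro linear_Der d) auto
  then show ?thesis using s e by (auto simp: linear_scale)
qed

text \<open>The second difference is symmetric in \<open>u\<close> and \<open>v\<close>, the
  derivative on the right is not visibly so; comparing both orders on small balls gives the
  symmetry. The mean value theorem is used twice: along \<open>u\<close> for the increment of
  \<open>f\<close> in direction \<open>v\<close>, then along \<open>v\<close> for
  \<open>Der f y u\<close>.\<close>

lemma second_difference:
  fixes f :: "'v::euclidean_space \<Rightarrow> real"
  assumes f: "smooth_on S f" and S: "open S" "ball x d \<subseteq> S"
    and t: "t > 0" "t * norm u + t * norm v < d"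
  shows "\<exists>z\<in>ball x d. f (x + t *\<^sub>R u + t *\<^sub>R v) - f (x + t *\<^sub>R u) - f (x + t *\<^sub>R v) + f x
    = t * t * Der (\<lambda>y. Der f y u) z v"
proof -
  have inb: "x + a *\<^sub>R u + b *\<^sub>R v \<in> ball x d" if "0 \<le> a" "a \<le> t" "0 \<le> b" "b \<le> t" for a b
  proof -
    have "norm (a *\<^sub>R u + b *\<^sub>R v) \<le> a * norm u + b * norm v"
      using that by (metis norm_triangle_ineq norm_scaleR abs_of_nonneg)
    also have "\<dots> \<le> t * norm u + t * norm v"
      using that by (intro add_mono mult_right_mono) auto
    finally have "dist (x + (a *\<^sub>R u + b *\<^sub>R v)) x < d"
      using t unfolding dist_norm add_diff_cancel_left' by linarith
    then show ?thesis by (simp add: add.assoc dist_commute)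
  qed
  define \<phi> where "\<phi> = (\<lambda>y. f (y + t *\<^sub>R v) - f y)"
  have fd: "f differentiable (at y)" if "y \<in> ball x d" for y
    using that S f smooth_on_differentiable by blast
  have fvd: "(\<lambda>y. f (y + t *\<^sub>R v)) differentiable (at y)"
    and Dfv: "Der (\<lambda>y. f (y + t *\<^sub>R v)) y = Der f (y + t *\<^sub>R v)" if "y + t *\<^sub>R v \<in> ball x d" for y
  proof -
    have "((\<lambda>y. y + t *\<^sub>R v) has_derivative (\<lambda>h. h)) (at y)"
      by (auto intro!: derivative_eq_intros)
    from has_derivative_compose[OF this differentiable_has_Der[OF fd[OF that]]]
    have "((\<lambda>y. f (y + t *\<^sub>R v)) has_derivative Der f (y + t *\<^sub>R v)) (at y)" by simp
    then show "(\<lambda>y. f (y + t *\<^sub>R v)) differentiable (at y)"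
      "Der (\<lambda>y. f (y + t *\<^sub>R v)) y = Der f (y + t *\<^sub>R v)"
      by (auto simp: differentiable_def intro: Der_eqI)
  qed
  have \<phi>d: "(\<phi> has_derivative (\<lambda>h. Der f (y + t *\<^sub>R v) h - Der f y h)) (at y)"
    if "y \<in> ball x d" "y + t *\<^sub>R v \<in> ball x d" for y
    unfolding \<phi>_def
    using has_derivative_diff[OF differentiable_has_Der[OF fvd[OF that(2)]] differentiable_has_Der[OF fd[OF that(1)]]]
    by (simp add: Dfv[OF that(2)])
  have b1: "x + s *\<^sub>R u \<in> ball x d" "x + s *\<^sub>R u + t *\<^sub>R v \<in> ball x d" if "0 \<le> s" "s \<le> t" for s
    using that t(1) inb[of s 0] inb[of s t] by auto
  have "\<exists>s. 0 < s \<and> s < t \<and> \<phi> (x + t *\<^sub>R u) - \<phi> x = t * Der \<phi> (x + s *\<^sub>R u) u"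
    by (rule mvt_line[OF t(1)]) (use \<phi>d b1 in \<open>auto simp: differentiable_def\<close>)
  then obtain s where s: "0 < s" "s < t" "\<phi> (x + t *\<^sub>R u) - \<phi> x = t * Der \<phi> (x + s *\<^sub>R u) u"
    by blast
  have b1': "x + s *\<^sub>R u \<in> ball x d" "x + s *\<^sub>R u + t *\<^sub>R v \<in> ball x d"
    using b1 s by auto
  have e2: "Der \<phi> (x + s *\<^sub>R u) u = Der f (x + s *\<^sub>R u + t *\<^sub>R v) u - Der f (x + s *\<^sub>R u) u"
    using Der_eqI[OF \<phi>d[OF b1']] by simp
  have "\<exists>r. 0 < r \<and> r < t \<and> Der f (x + s *\<^sub>R u + t *\<^sub>R v) u - Der f (x + s *\<^sub>R u) u
    = t * Der (\<lambda>y. Der f y u) (x + s *\<^sub>R u + r *\<^sub>R v) v"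
  proof (rule mvt_line[OF t(1)])
    fix r :: real assume "0 \<le> r" "r \<le> t"
    then have "x + s *\<^sub>R u + r *\<^sub>R v \<in> S" using inb[of s r] s S by auto
    then show "(\<lambda>y. Der f y u) differentiable at (x + s *\<^sub>R u + r *\<^sub>R v)"
      using smooth_on_differentiable[OF smooth_on_Der[OF f] S(1)] by blast
  qed
  then obtain r where r: "0 < r" "r < t" "Der f (x + s *\<^sub>R u + t *\<^sub>R v) u - Der f (x + s *\<^sub>R u) u
    = t * Der (\<lambda>y. Der f y u) (x + s *\<^sub>R u + r *\<^sub>R v) v" by blast
  have "x + s *\<^sub>R u + r *\<^sub>R v \<in> ball x d" using inb[of s r] s r by auto
  moreover have "f (x + t *\<^sub>R u + t *\<^sub>R v) - f (x + t *\<^sub>R u) - f (x + t *\<^sub>R v) + f x = \<phi> (x + t *\<^sub>R u) - \<phi> x"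
    by (simp add: \<phi>_def)
  ultimately show ?thesis using s(3) e2 r(3) by (metis mult.assoc)
qed

lemma Der_commute_real:
  fixes f :: "'v::euclidean_space \<Rightarrow> real"
  assumes f: "smooth_on S f" and S: "open S" "x \<in> S"
  shows "Der (\<lambda>y. Der f y u) x v = Der (\<lambda>y. Der f y v) x u"
proof -
  have "\<bar>Der (\<lambda>y. Der f y u) x v - Der (\<lambda>y. Der f y v) x u\<bar> < e" if e: "e > 0" for e
  proof -
    have c: "\<exists>d>0. ball x d \<subseteq> S \<and> (\<forall>y\<in>ball x d. \<bar>Der (\<lambda>y. Der f y u) y v - Der (\<lambda>y. Der f y u) x v\<bar> < e / 2)"
      for u v
    proof -
      have "isCont (\<lambda>y. Der (\<lambda>y. Der f y u) y v) x"
        using smooth_on_continuous[OF smooth_on_Der[OF smooth_on_Der[OF f]]] S continuous_on_eq_continuous_at by blast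
      then obtain d1 where "d1 > 0" "\<And>y. dist y x < d1 \<Longrightarrow> \<bar>Der (\<lambda>y. Der f y u) y v - Der (\<lambda>y. Der f y u) x v\<bar> < e / 2"
        unfolding continuous_at_eps_delta dist_real_def using e by (metis half_gt_zero_iff)
      moreover obtain d2 where "d2 > 0" "ball x d2 \<subseteq> S" using S openE by blast
      ultimately show ?thesis
        by (intro exI[of _ "min d1 d2"]) (auto simp: dist_commute)
    qed
    obtain d where d: "d > 0" "ball x d \<subseteq> S"
      and d1: "\<And>y. y \<in> ball x d \<Longrightarrow> \<bar>Der (\<lambda>y. Der f y u) y v - Der (\<lambda>y. Der f y u) x v\<bar> < e / 2"
      and d2: "\<And>y. y \<in> ball x d \<Longrightarrow> \<bar>Der (\<lambda>y. Der f y v) y u - Der (\<lambda>y. Der f y v) x u\<bar> < e / 2"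
    proof -
      obtain a where "a > 0" "ball x a \<subseteq> S"
        "\<forall>y\<in>ball x a. \<bar>Der (\<lambda>y. Der f y u) y v - Der (\<lambda>y. Der f y u) x v\<bar> < e / 2"
        using c by blast
      moreover obtain b where "b > 0" 
        "\<forall>y\<in>ball x b. \<bar>Der (\<lambda>y. Der f y v) y u - Der (\<lambda>y. Der f y v) x u\<bar> < e / 2"
        using c by blast
      ultimately show thesis by (intro that[of "min a b"]) auto
    qed
    \<comment> \<open>Small enough for the parallelogram spanned by \<open>t\<close> times
      \<open>u\<close> and \<open>v\<close> to stay in the ball; the summand 1 keeps the denominator
      positive when \<open>u\<close> and \<open>v\<close> vanish.\<close>
    define t where "t = d / (2 * (norm u + norm v + 1))"
    have t: "t > 0" "t * norm u + t * norm v < d"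
    proof -
      have p: "norm u + norm v + 1 > 0" by (simp add: add_nonneg_pos)
      then show "t > 0" using d by (simp add: t_def)
      have "t * norm u + t * norm v < t * (2 * (norm u + norm v + 1))"
        using \<open>t > 0\<close> by (simp add: algebra_simps add_nonneg_pos)
      also have "\<dots> = d" using p by (simp add: t_def)
      finally show "t * norm u + t * norm v < d" .
    qed
    obtain z1 where z1: "z1 \<in> ball x d" "f (x + t *\<^sub>R u + t *\<^sub>R v) - f (x + t *\<^sub>R u) - f (x + t *\<^sub>R v) + f x
      = t * t * Der (\<lambda>y. Der f y u) z1 v"
      using second_difference[OF f S(1) d(2) t] by blast
    obtain z2 where z2: "z2 \<in> ball x d" "f (x + t *\<^sub>R v + t *\<^sub>R u) - f (x + t *\<^sub>R v) - f (x + t *\<^sub>R u) + f x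
      = t * t * Der (\<lambda>y. Der f y v) z2 u"
      using second_difference[OF f S(1) d(2) t(1), of v u] t(2) by (auto simp: add.commute)
    have "x + t *\<^sub>R v + t *\<^sub>R u = x + t *\<^sub>R u + t *\<^sub>R v" by (simp add: algebra_simps)
    then have "t * t * Der (\<lambda>y. Der f y u) z1 v = t * t * Der (\<lambda>y. Der f y v) z2 u"
      using z1(2) z2(2) by (simp only:)
    then have "Der (\<lambda>y. Der f y u) z1 v = Der (\<lambda>y. Der f y v) z2 u"
      using t by simp
    then show ?thesis using d1[OF z1(1)] d2[OF z2(1)] by linarith
  qed
  \<comment> \<open>With the difference itself as \<open>e\<close>, a nonzero value would be smaller
    than itself.\<close>
  from this[of "\<bar>Der (\<lambda>y. Der f y u) x v - Der (\<lambda>y. Der f y v) x u\<bar>"] show ?thesis by fastforce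
qed

lemma Der_linear:
  assumes "bounded_linear L" "f differentiable (at x)"
  shows "Der (\<lambda>x. L (f x)) x v = L (Der f x v)"
  by (rule fun_cong[OF Der_eqI[OF bounded_linear.has_derivative[OF assms(1) differentiable_has_Der[OF assms(2)]]]])

text \<open>The mean value theorem behind \<open>Der_commute_real\<close> concerns real values, so
  the vector-valued case is reduced to coordinates.\<close>

lemma Der_commute:
  fixes f :: "'v::euclidean_space \<Rightarrow> 'w::euclidean_space"
  assumes f: "smooth_on S f" and S: "open S" "x \<in> S"
  shows "Der (\<lambda>y. Der f y u) x v = Der (\<lambda>y. Der f y v) x u"
proof (rule euclidean_eqI)
  fix b :: 'w assume "b \<in> Basis"
  have L: "bounded_linear (\<lambda>w::'w. w \<bullet> b)" by (rule bounded_linear_inner_left)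
  have *: "Der (\<lambda>y. Der f y u) x v \<bullet> b = Der (\<lambda>y. Der (\<lambda>z. f z \<bullet> b) y u) x v" for u v
  proof -
    have "Der (\<lambda>y. Der (\<lambda>z. f z \<bullet> b) y u) x v = Der (\<lambda>y. Der f y u \<bullet> b) x v"
      by (rule fun_cong[OF Der_cong_open[OF S]])
        (simp add: Der_linear[OF L] smooth_on_differentiable[OF f S(1)])
    also have "\<dots> = Der (\<lambda>y. Der f y u) x v \<bullet> b"
      by (rule Der_linear[OF L]) (rule smooth_on_differentiable[OF smooth_on_Der[OF f] S])
    finally show ?thesis by simp
  qed
  show "Der (\<lambda>y. Der f y u) x v \<bullet> b = Der (\<lambda>y. Der f y v) x u \<bullet> b"
    unfolding * by (rule Der_commute_real[OF smooth_on_linear[OF L S(1) f] S])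
qed

text \<open>A linear map is determined by its values on \<open>Basis\<close>, so smoothness for
  fixed arguments suffices. This makes a differential applied to a moving vector smooth, as occurs
  in the construction and transport of normal fields.\<close>

lemma smooth_on_linear_family:
  fixes L :: "'v::euclidean_space \<Rightarrow> 'p::euclidean_space \<Rightarrow> 'w::real_normed_vector"
  assumes S: "open S" and L: "\<And>v. smooth_on S (\<lambda>y. L y v)" "\<And>y. y \<in> S \<Longrightarrow> linear (L y)" and t: "smooth_on S t"
  shows "smooth_on S (\<lambda>y. L y (t y))"
proof -
  have "smooth_on S (\<lambda>y. \<Sum>i\<in>Basis. (t y \<bullet> i) *\<^sub>R L y i)"
    by (intro smooth_on_sum smooth_on_scaleR smooth_on_inner smooth_on_const S t L)
  then show ?thesis
    by (rule smooth_on_transform[OF _ S]) (rule linear_Basis_expand[OF L(2)])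
qed

lemma bilinear_Basis_expand:
  fixes p :: "'p::euclidean_space" and q :: "'q::euclidean_space"
  assumes "\<And>q. linear (\<lambda>p. B p q)" "\<And>p. linear (B p)"
  shows "B p q = (\<Sum>i\<in>Basis. \<Sum>j\<in>Basis. ((p \<bullet> i) * (q \<bullet> j)) *\<^sub>R B i j)"
proof -
  have "B p q = (\<Sum>i\<in>Basis. (p \<bullet> i) *\<^sub>R B i q)"
    by (rule linear_Basis_expand[OF assms(1)])
  also have "\<dots> = (\<Sum>i\<in>Basis. (p \<bullet> i) *\<^sub>R (\<Sum>j\<in>Basis. (q \<bullet> j) *\<^sub>R B i j))"
    using linear_Basis_expand[OF assms(2)] by (metis (no_types, lifting))
  finally show ?thesis by (simp add: scaleR_sum_right)
qed

text \<open>The fields \<open>B\<close> below are the metric and the Christoffel symbols; \<open>F\<close> is the map along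
  which they are pulled back.\<close>

locale bilinear_field =
  fixes B :: "'y::euclidean_space \<Rightarrow> 'p::euclidean_space \<Rightarrow> 'q::euclidean_space \<Rightarrow> 'w::real_normed_vector"
    and T :: "'y set"
  assumes open_T: "open T"
    and lin1: "\<And>y q. linear (\<lambda>p. B y p q)" and lin2: "\<And>y p. linear (B y p)"
    and smooth_B: "\<And>p q. smooth_on T (\<lambda>y. B y p q)"
begin

lemma smooth:
  fixes F :: "'v::euclidean_space \<Rightarrow> 'y"
  assumes S: "open S" and F: "smooth_on S F" "F ` S \<subseteq> T" and PQ: "smooth_on S P" "smooth_on S Q"
  shows "smooth_on S (\<lambda>x. B (F x) (P x) (Q x))"
  unfolding bilinear_Basis_expand[OF lin1 lin2, of _ "P _"]
  by (intro smooth_on_sum smooth_on_scaleR smooth_on_mult smooth_on_inner smooth_on_const PQ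
      smooth_on_compose[OF S open_T F(2) _ F(1)] smooth_B S)

text \<open>Expanding both arguments in \<open>Basis\<close> reduces the claim to products of scalar
  functions with values of \<open>B\<close> at fixed arguments. For the metric this leads to
  \<open>D_ip\<close>, for the Christoffel symbols to \<open>D_commute\<close>.\<close>

lemma Der:
  fixes F :: "'v::euclidean_space \<Rightarrow> 'y"
  assumes F: "F differentiable (at x)" "F x \<in> T" and P: "P differentiable (at x)" and Q: "Q differentiable (at x)"
  shows "Der (\<lambda>x. B (F x) (P x) (Q x)) x u =
    Der (\<lambda>y. B y (P x) (Q x)) (F x) (Der F x u) + B (F x) (Der P x u) (Q x) + B (F x) (P x) (Der Q x u)"
proof -
  note ex = bilinear_Basis_expand[OF lin1 lin2]
  have DB: "((\<lambda>y. B y p q) has_derivative Der (\<lambda>y. B y p q) (F x)) (at (F x))" for p q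
    by (rule smooth_on_has_Der[OF smooth_B open_T F(2)])
  have Dx: "((\<lambda>x. B (F x) p q) has_derivative (\<lambda>u. Der (\<lambda>y. B y p q) (F x) (Der F x u))) (at x)" for p q
    using has_derivative_compose[OF differentiable_has_Der[OF F(1)] DB] .
  have ex1: "(\<lambda>y. B y (P x) (Q x)) = (\<lambda>y. \<Sum>i\<in>Basis. \<Sum>j\<in>Basis. ((P x \<bullet> i) * (Q x \<bullet> j)) *\<^sub>R B y i j)"
    by (rule ext) (rule ex)
  have ex2: "(\<lambda>x. B (F x) (P x) (Q x)) = (\<lambda>x. \<Sum>i\<in>Basis. \<Sum>j\<in>Basis. ((P x \<bullet> i) * (Q x \<bullet> j)) *\<^sub>R B (F x) i j)"
    by (rule ext) (rule ex)
  have "((\<lambda>y. \<Sum>i\<in>Basis. \<Sum>j\<in>Basis. ((P x \<bullet> i) * (Q x \<bullet> j)) *\<^sub>R B y i j) has_derivative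
     (\<lambda>h. \<Sum>i\<in>Basis. \<Sum>j\<in>Basis. ((P x \<bullet> i) * (Q x \<bullet> j)) *\<^sub>R Der (\<lambda>y. B y i j) (F x) h)) (at (F x))"
    by (intro has_derivative_sum has_derivative_scaleR_right DB)
  then have e1: "Der (\<lambda>y. B y (P x) (Q x)) (F x) h
      = (\<Sum>i\<in>Basis. \<Sum>j\<in>Basis. ((P x \<bullet> i) * (Q x \<bullet> j)) *\<^sub>R Der (\<lambda>y. B y i j) (F x) h)" for h
    unfolding ex1 by (rule fun_cong[OF Der_eqI])
  have DP: "((\<lambda>x. P x \<bullet> i) has_derivative (\<lambda>u. Der P x u \<bullet> i)) (at x)" for i
    by (intro has_derivative_inner_left differentiable_has_Der P)
  have DQ: "((\<lambda>x. Q x \<bullet> i) has_derivative (\<lambda>u. Der Q x u \<bullet> i)) (at x)" for i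
    by (intro has_derivative_inner_left differentiable_has_Der Q)
  have "((\<lambda>x. \<Sum>i\<in>Basis. \<Sum>j\<in>Basis. ((P x \<bullet> i) * (Q x \<bullet> j)) *\<^sub>R B (F x) i j) has_derivative
     (\<lambda>u. \<Sum>i\<in>Basis. \<Sum>j\<in>Basis. ((P x \<bullet> i) * (Q x \<bullet> j)) *\<^sub>R Der (\<lambda>y. B y i j) (F x) (Der F x u)
        + ((P x \<bullet> i) * (Der Q x u \<bullet> j) + (Der P x u \<bullet> i) * (Q x \<bullet> j)) *\<^sub>R B (F x) i j)) (at x)"
    by (intro has_derivative_sum has_derivative_scaleR has_derivative_mult Dx DP DQ)
  then have "Der (\<lambda>x. B (F x) (P x) (Q x)) x u =
     (\<Sum>i\<in>Basis. \<Sum>j\<in>Basis. ((P x \<bullet> i) * (Q x \<bullet> j)) *\<^sub>R Der (\<lambda>y. B y i j) (F x) (Der F x u)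
        + ((P x \<bullet> i) * (Der Q x u \<bullet> j) + (Der P x u \<bullet> i) * (Q x \<bullet> j)) *\<^sub>R B (F x) i j)"
    unfolding ex2 by (rule fun_cong[OF Der_eqI])
  also have "\<dots> = Der (\<lambda>y. B y (P x) (Q x)) (F x) (Der F x u) + B (F x) (Der P x u) (Q x) + B (F x) (P x) (Der Q x u)"
    unfolding e1 ex[of "F x" "Der P x u"] ex[of "F x" "P x"]
    by (simp add: scaleR_add_left sum.distrib algebra_simps)
  finally show ?thesis .
qed

lemma linear_Der_field1:
  assumes "y \<in> T"
  shows "linear (\<lambda>p. Der (\<lambda>y. B y p q) y u)"
proof (rule linearI)
  have D: "((\<lambda>y. B y p q) has_derivative Der (\<lambda>y. B y p q) y) (at y)" for p
    by (rule smooth_on_has_Der[OF smooth_B open_T assms])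
  have "(\<lambda>y. B y (p + p') q) = (\<lambda>y. B y p q + B y p' q)" for p p'
    using linear_add[OF lin1] by blast
  then show "Der (\<lambda>y. B y (p + p') q) y u = Der (\<lambda>y. B y p q) y u + Der (\<lambda>y. B y p' q) y u" for p p'
    using fun_cong[OF Der_eqI[OF has_derivative_add[OF D D]]] by simp
  have "(\<lambda>y. B y (c *\<^sub>R p) q) = (\<lambda>y. c *\<^sub>R B y p q)" for c p
    using linear_scale[OF lin1] by blast
  then show "Der (\<lambda>y. B y (c *\<^sub>R p) q) y u = c *\<^sub>R Der (\<lambda>y. B y p q) y u" for c p
    using fun_cong[OF Der_eqI[OF has_derivative_scaleR_right[OF D]]] by simp
qed

end

section \<open>Riemannian metrics in coordinates\<close>

lemma matrix_inv_right_left: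
  fixes A :: "real ^ 'n ^ 'n"
  assumes "invertible A"
  shows "A ** matrix_inv A = mat 1" "matrix_inv A ** A = mat 1"
  using someI_ex[OF assms[unfolded invertible_def]] by (auto simp: matrix_inv_def)

lemma linear_ip1: "linear (\<lambda>u. ip g x u v)"
  unfolding ip_def by (rule linearI) (auto simp: inner_add_left)

lemma linear_ip2: "linear (ip g x u)"
  unfolding ip_def by (rule linearI)
    (auto simp: inner_add_right matrix_vector_right_distrib matrix_vector_mult_scaleR)

lemmas ip_simps [simp] =
  linear_add[OF linear_ip1] linear_add[OF linear_ip2]
  linear_diff[OF linear_ip1] linear_diff[OF linear_ip2]
  linear_neg[OF linear_ip1] linear_neg[OF linear_ip2]
  linear_scale[OF linear_ip1] linear_scale[OF linear_ip2]
  linear_0[OF linear_ip1] linear_0[OF linear_ip2]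
  linear_sum[OF linear_ip1] linear_sum[OF linear_ip2]

lemma linear_axis_expand:
  fixes v :: "real ^ 'n"
  assumes "linear L"
  shows "L v = (\<Sum>i\<in>UNIV. v $ i *\<^sub>R L (axis i 1))"
proof -
  have "L v = L (\<Sum>i\<in>UNIV. v $ i *\<^sub>R axis i 1)"
    by (metis (no_types, lifting) basis_expansion scalar_mult_eq_scaleR sum.cong)
  also have "\<dots> = (\<Sum>i\<in>UNIV. v $ i *\<^sub>R L (axis i 1))"
    by (simp add: linear_sum[OF assms] linear_scale[OF assms])
  finally show ?thesis .
qed

text \<open>The standard basis is expanded in the family \<open>E\<close> and then summed back. The
  index set is independent of the dimension type, so the lemma serves frames of M as well as the
  frame of N consisting of the image of a frame of M and the normal.\<close>

lemma trace_matrix_expansion: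
  fixes E :: "'k \<Rightarrow> real ^ 'n"
  assumes L: "linear L" and E: "\<And>w. w = (\<Sum>a\<in>I. ip g x w (E a) *\<^sub>R E a)"
  shows "trace (matrix L) = (\<Sum>a\<in>I. ip g x (L (E a)) (E a))"
proof -
  have "trace (matrix L) = (\<Sum>j\<in>UNIV. L (axis j 1) $ j)"
    by (simp add: trace_def matrix_def)
  also have "\<dots> = (\<Sum>j\<in>UNIV. L (\<Sum>a\<in>I. ip g x (axis j 1) (E a) *\<^sub>R E a) $ j)"
    by (simp flip: E)
  also have "\<dots> = (\<Sum>j\<in>UNIV. \<Sum>a\<in>I. ip g x (axis j 1) (E a) * L (E a) $ j)"
    by (simp add: linear_sum[OF L] linear_scale[OF L])
  also have "\<dots> = (\<Sum>a\<in>I. \<Sum>j\<in>UNIV. L (E a) $ j *\<^sub>R ip g x (axis j 1) (E a))"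
    by (subst sum.swap) (simp add: mult.commute)
  also have "\<dots> = (\<Sum>a\<in>I. ip g x (L (E a)) (E a))"
    by (rule sum.cong[OF refl]) (rule linear_axis_expand[OF linear_ip1, symmetric])
  finally show ?thesis .
qed

lemma trace_matrix_commutator:
  fixes K L :: "real ^ 'n \<Rightarrow> real ^ 'n"
  assumes "linear K" "linear L"
  shows "trace (matrix (\<lambda>v. K (L v))) = trace (matrix (\<lambda>v. L (K v)))"
  using trace_mul_sym[of "matrix K" "matrix L"] matrix_compose[of L K] matrix_compose[of K L] assms
  by (simp add: o_def)

lemma linear_coefficients:
  fixes C :: "'n::finite \<Rightarrow> 'm::finite \<Rightarrow> 'm \<Rightarrow> real"
  shows "linear (\<lambda>u. (\<chi> k. \<Sum>i\<in>UNIV. \<Sum>j\<in>UNIV. C k i j * u $ i * v $ j))"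
    and "linear (\<lambda>v. (\<chi> k. \<Sum>i\<in>UNIV. \<Sum>j\<in>UNIV. C k i j * u $ i * v $ j))"
  by (auto intro!: linearI simp: vec_eq_iff algebra_simps sum.distrib sum_distrib_left)

lemma linear_christoffel1: "linear (\<lambda>u. christoffel g x u v)"
  unfolding christoffel_def Let_def by (rule linear_coefficients(1))

lemma linear_christoffel2: "linear (christoffel g x u)"
  unfolding christoffel_def Let_def by (rule linear_coefficients(2))

section \<open>A Riemannian metric on an open set of coordinates\<close>

locale metric_on =
  fixes g :: "real ^ 'm::finite \<Rightarrow> real ^ 'm ^ 'm" and S :: "(real ^ 'm) set"
  assumes open_S: "open S" and smooth_g: "smooth_on S g"
    and ip_sym: "x \<in> S \<Longrightarrow> ip g x u v = ip g x v u"
    and ip_pos: "x \<in> S \<Longrightarrow> u \<noteq> 0 \<Longrightarrow> ip g x u u > 0"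
begin

lemma ip_eqI:
  assumes "x \<in> S" "\<And>v. ip g x u v = ip g x w v"
  shows "u = w"
proof (rule ccontr)
  assume "u \<noteq> w"
  then have "ip g x (u - w) (u - w) > 0" using ip_pos[OF assms(1), of "u - w"] by simp
  \<comment> \<open>Additivity in the second argument is switched off, so that only the first one is
    split and the hypothesis still matches.\<close>
  moreover have "ip g x (u - w) (u - w) = 0" using assms(2)[of "u - w"] by (simp del: ip_simps(2) ip_simps(4))
  ultimately show False by simp
qed

lemma invertible_g:
  assumes "x \<in> S"
  shows "invertible (g x)"
proof -
  have "u = 0" if "g x *v u = 0" for u
    using ip_pos[OF assms, of u] that by (auto simp: ip_def)
  then show ?thesis
    using matrix_left_invertible_ker[of "g x"] by (auto simp: invertible_left_inverse)
qed

lemma matrix_inv_g: "x \<in> S \<Longrightarrow> g x *v (matrix_inv (g x) *v v) = v"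
  by (simp add: matrix_vector_mul_assoc matrix_inv_right_left[OF invertible_g])

lemma smooth_g_nth: "smooth_on S (\<lambda>y. g y $ i $ j)"
  by (intro smooth_on_nth open_S smooth_g)

lemma smooth_det:
  fixes A :: "real ^ 'm \<Rightarrow> real ^ 'm ^ 'm"
  assumes "\<And>i j. smooth_on S (\<lambda>y. A y $ i $ j)"
  shows "smooth_on S (\<lambda>y. det (A y))"
  unfolding det_def
  by (intro smooth_on_sum smooth_on_mult smooth_on_const smooth_on_prod open_S assms)

text \<open>By Cramer's rule the entries of the inverse are quotients of determinants, which are
  polynomials in matrix entries.\<close>

lemma smooth_matrix_inv: "smooth_on S (\<lambda>y. matrix_inv (g y) $ k $ l)"
proof -
  have d: "det (g y) \<noteq> 0" if "y \<in> S" for y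
    using invertible_g[OF that] invertible_det_nz by blast
  have eq: "matrix_inv (g y) $ k $ l =
      det (\<chi> i j. if j = k then axis l 1 $ i else g y $ i $ j) * inverse (det (g y))" if y: "y \<in> S" for y
  proof -
    have "g y *v (matrix_inv (g y) *v axis l 1) = axis l 1" by (rule matrix_inv_g[OF y])
    then have "(matrix_inv (g y) *v axis l 1) $ k
        = det (\<chi> i j. if j = k then axis l 1 $ i else g y $ i $ j) / det (g y)"
      using cramer[OF d[OF y]] by simp
    then show ?thesis
      by (simp add: matrix_vector_mult_basis column_def divide_inverse)
  qed
  have sm: "smooth_on S (\<lambda>y. det (\<chi> i j. if j = k then axis l 1 $ i else g y $ i $ j) * inverse (det (g y)))"
  proof (intro smooth_on_mult smooth_on_inverse smooth_det open_S d smooth_g_nth)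
    show "smooth_on S (\<lambda>y. (\<chi> i j. if j = k then axis l 1 $ i else g y $ i $ j) $ i $ j)" for i j
      by (cases "j = k") (simp_all add: smooth_on_const smooth_g_nth)
  qed
  show ?thesis by (rule smooth_on_transform[OF sm open_S eq])
qed

text \<open>An explicit formula replaces the definite description in \<open>sharp\<close>; it
  settles existence of the representing vector and opens the way to its smoothness.\<close>

lemma sharp_eq:
  assumes x: "x \<in> S" and \<alpha>: "linear \<alpha>"
  shows "sharp g x \<alpha> = matrix_inv (g x) *v (\<chi> j. \<alpha> (axis j 1))"
  unfolding sharp_def
proof (rule the_equality)
  have "ip g x w v = \<alpha> v" if "w = matrix_inv (g x) *v (\<chi> j. \<alpha> (axis j 1))" for w v
  proof -
    have "ip g x w v = ip g x v w" by (rule ip_sym[OF x])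
    also have "\<dots> = (\<Sum>j\<in>UNIV. v $ j *\<^sub>R \<alpha> (axis j 1))"
      by (simp add: ip_def that matrix_inv_g[OF x] inner_vec_def)
    also have "\<dots> = \<alpha> v" by (rule linear_axis_expand[OF \<alpha>, symmetric])
    finally show ?thesis .
  qed
  then show sh: "\<forall>v. ip g x (matrix_inv (g x) *v (\<chi> j. \<alpha> (axis j 1))) v = \<alpha> v" by blast
  show "w = matrix_inv (g x) *v (\<chi> j. \<alpha> (axis j 1))" if "\<forall>v. ip g x w v = \<alpha> v" for w
    by (rule ip_eqI[OF x]) (simp add: that sh)
qed

lemma ip_sharp:
  assumes x: "x \<in> S" and \<alpha>: "linear \<alpha>"
  shows "ip g x (sharp g x \<alpha>) v = \<alpha> v"
proof -
  have "ip g x (sharp g x \<alpha>) v = ip g x v (sharp g x \<alpha>)" by (rule ip_sym[OF x])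
  also have "\<dots> = (\<Sum>j\<in>UNIV. v $ j *\<^sub>R \<alpha> (axis j 1))"
    by (simp add: ip_def sharp_eq[OF x \<alpha>] matrix_inv_g[OF x] inner_vec_def)
  also have "\<dots> = \<alpha> v" by (rule linear_axis_expand[OF \<alpha>, symmetric])
  finally show ?thesis .
qed

lemma smooth_sharp:
  assumes "T \<subseteq> S" "open T" "\<And>y. y \<in> T \<Longrightarrow> linear (\<alpha> y)" "\<And>v. smooth_on T (\<lambda>y. \<alpha> y v)"
  shows "smooth_on T (\<lambda>y. sharp g y (\<alpha> y))"
proof -
  have "smooth_on T (\<lambda>y. (matrix_inv (g y) *v (\<chi> j. \<alpha> y (axis j 1))))"
    by (rule smooth_on_vec[OF assms(2)])
      (auto simp: matrix_vector_mult_def intro!: smooth_on_sum smooth_on_mult assms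
        smooth_on_subset[OF smooth_matrix_inv])
  moreover have "sharp g y (\<alpha> y) = matrix_inv (g y) *v (\<chi> j. \<alpha> y (axis j 1))" if "y \<in> T" for y
    using that assms(1,3) sharp_eq by blast
  ultimately show ?thesis by (rule smooth_on_transform[OF _ assms(2)])
qed

section \<open>Orthonormal frames and metric traces\<close>

lemma orthonormal_independent:
  assumes x: "x \<in> S" and e: "\<And>s t. s \<in> E \<Longrightarrow> t \<in> E \<Longrightarrow> ip g x s t = (if s = t then 1 else 0)"
  shows "independent E"
  unfolding independent_explicit_module
proof clarify
  fix t u v assume t: "finite t" "t \<subseteq> E" "(\<Sum>v\<in>t. u v *\<^sub>R v) = 0" "v \<in> t"
  have "0 = ip g x (\<Sum>v\<in>t. u v *\<^sub>R v) v" using t by simp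
  also have "\<dots> = (\<Sum>w\<in>t. if w = v then u v else 0)"
    unfolding ip_simps using t e by (intro sum.cong) (auto simp: subset_iff)
  also have "\<dots> = u v" using t by simp
  finally show "u v = 0" by simp
qed

lemma orthonormal_frame_exists:
  assumes x: "x \<in> S"
  shows "\<exists>e. orthonormal_frame g x e"
proof -
  define P where "P = (\<lambda>E. \<forall>s\<in>E. \<forall>t\<in>E. ip g x s t = (if s = t then 1 else 0))"
  have ind: "independent E" if "P E" for E
    using orthonormal_independent[OF x] that unfolding P_def by blast
  have "\<exists>E. P E \<and> finite E \<and> card E = k" if "k \<le> CARD('m)" for k
    using that
  proof (induction k)
    case 0
    then show ?case by (intro exI[of _ "{}"]) (auto simp: P_def)
  next
    case (Suc k)
    then obtain E where E: "P E" "finite E" "card E = k" by auto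
    have "span E \<noteq> UNIV"
      using dim_eq_card_independent[OF ind[OF E(1)]] E(3) Suc.prems dim_span[of E]
      by (metis DIM_cart DIM_real Suc_n_not_le_n dim_UNIV mult.right_neutral)
    then obtain v where v: "v \<notin> span E" by blast
    \<comment> \<open>Gram-Schmidt: the projection to the span of \<open>E\<close> is removed, and
      the remainder is nonzero because \<open>v\<close> lies outside that span.\<close>
    define z where "z = v - (\<Sum>s\<in>E. ip g x v s *\<^sub>R s)"
    have "(\<Sum>s\<in>E. ip g x v s *\<^sub>R s) \<in> span E" by (intro span_sum span_scale span_base)
    then have z0: "z \<noteq> 0" using v by (auto simp: z_def)
    have zs: "ip g x z s = 0" if "s \<in> E" for s
    proof -
      have "ip g x z s = ip g x v s - (\<Sum>t\<in>E. if t = s then ip g x v s else 0)"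
        unfolding z_def ip_simps using E(1) that by (auto simp: P_def intro!: sum.cong)
      then show ?thesis using E(2) that by simp
    qed
    define c where "c = ip g x z z"
    have c: "c > 0" using ip_pos[OF x z0] by (simp add: c_def)
    define n where "n = (1 / sqrt c) *\<^sub>R z"
    have n: "ip g x n n = 1" using c by (simp add: n_def c_def[symmetric] real_div_sqrt field_simps)
    have ns: "ip g x n s = 0" "ip g x s n = 0" if "s \<in> E" for s
      using zs[OF that] ip_sym[OF x, of s z] by (simp_all add: n_def)
    have "n \<notin> E" using n ns by fastforce
    then show ?case
      using E n ns by (intro exI[of _ "insert n E"]) (auto simp: P_def)
  qed
  from this[of "CARD('m)"] obtain E where E: "P E" "finite E" "card E = CARD('m)" by blast
  then obtain e :: "'m \<Rightarrow> real ^ 'm" where e: "bij_betw e UNIV E"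
    by (metis finite finite_same_card_bij)
  then have "orthonormal_frame g x e"
    using E(1) unfolding orthonormal_frame_def P_def bij_betw_def by (auto simp: inj_eq)
  then show ?thesis by blast
qed

lemma frame_expand:
  assumes x: "x \<in> S" and e: "orthonormal_frame g x e"
  shows "w = (\<Sum>i\<in>UNIV. ip g x w (e i) *\<^sub>R e i)"
proof -
  have "inj e"
    using e unfolding orthonormal_frame_def inj_def by (metis zero_neq_one)
  then have "independent (range e)"
    using e by (intro orthonormal_independent[OF x]) (auto simp: orthonormal_frame_def inj_eq)
  moreover have "card (range e) = CARD('m)" using \<open>inj e\<close> by (simp add: card_image)
  ultimately have "span (range e) = UNIV"
    using dim_eq_card_independent[of "range e"] dim_eq_full[of "range e"] by simp
  then have "w \<in> span (range e)" by simp
  then obtain c where "w = (\<Sum>v\<in>range e. c v *\<^sub>R v)"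
    using span_finite[of "range e"] by auto
  then obtain u where u: "w = (\<Sum>i\<in>UNIV. u i *\<^sub>R e i)"
    using sum.reindex[OF \<open>inj e\<close>, of "\<lambda>v. c v *\<^sub>R v"] by (auto simp: o_def)
  have "ip g x w (e j) = (\<Sum>i\<in>UNIV. if i = j then u j else 0)" for j
    unfolding u ip_simps using e by (intro sum.cong) (auto simp: orthonormal_frame_def)
  then have "ip g x w (e j) = u j" for j by simp
  then show ?thesis using u by simp
qed

lemma frame_trace:
  assumes "x \<in> S" "orthonormal_frame g x e" "linear L"
  shows "trace (matrix L) = (\<Sum>i\<in>UNIV. ip g x (L (e i)) (e i))"
  by (rule trace_matrix_expansion[OF assms(3) frame_expand[OF assms(1,2)]])

text \<open>For an orthonormal frame the (i, j) entry of the inverse metric is the sum over k of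
  \<open>e k $ i * e k $ j\<close>; inserted into the coordinate trace, it regroups by bilinearity
  to the sum over the frame.\<close>

lemma frame_trace_g:
  fixes B :: "real ^ 'm \<Rightarrow> real ^ 'm \<Rightarrow> 'w::real_vector"
  assumes x: "x \<in> S" and e: "orthonormal_frame g x e"
    and B: "\<And>v. linear (\<lambda>u. B u v)" "\<And>u. linear (B u)"
  shows "trace_g g x B = (\<Sum>i\<in>UNIV. B (e i) (e i))"
proof -
  have "matrix_inv (g x) *v v = (\<Sum>k\<in>UNIV. (v \<bullet> e k) *\<^sub>R e k)" for v
  proof (rule ip_eqI[OF x])
    fix w
    have "ip g x (matrix_inv (g x) *v v) w = ip g x w (matrix_inv (g x) *v v)" by (rule ip_sym[OF x])
    also have "\<dots> = v \<bullet> w" by (simp add: ip_def matrix_inv_g[OF x] inner_commute)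
    also have "\<dots> = v \<bullet> (\<Sum>k\<in>UNIV. ip g x w (e k) *\<^sub>R e k)"
      using frame_expand[OF x e, of w] by simp
    also have "\<dots> = ip g x (\<Sum>k\<in>UNIV. (v \<bullet> e k) *\<^sub>R e k) w"
      by (simp add: inner_sum_right ip_sym[OF x, of w] mult.commute)
    finally show "ip g x (matrix_inv (g x) *v v) w = ip g x (\<Sum>k\<in>UNIV. (v \<bullet> e k) *\<^sub>R e k) w" .
  qed
  from this[of "axis _ 1"] have inv: "matrix_inv (g x) $ i $ j = (\<Sum>k\<in>UNIV. e k $ i * e k $ j)" for i j
    by (simp add: matrix_vector_mult_basis column_def vec_eq_iff inner_axis' mult.commute)
  have row: "(\<Sum>j\<in>UNIV. (e k $ i * e k $ j) *\<^sub>R B (axis i 1) (axis j 1)) = e k $ i *\<^sub>R B (axis i 1) (e k)" for i k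
    by (subst linear_axis_expand[OF B(2), of _ "e k"]) (simp add: scaleR_sum_right)
  have "trace_g g x B = (\<Sum>i\<in>UNIV. \<Sum>j\<in>UNIV. \<Sum>k\<in>UNIV. (e k $ i * e k $ j) *\<^sub>R B (axis i 1) (axis j 1))"
    by (simp add: trace_g_def inv scaleR_sum_left)
  also have "\<dots> = (\<Sum>i\<in>UNIV. \<Sum>k\<in>UNIV. \<Sum>j\<in>UNIV. (e k $ i * e k $ j) *\<^sub>R B (axis i 1) (axis j 1))"
    by (rule sum.cong[OF refl], rule sum.swap)
  also have "\<dots> = (\<Sum>k\<in>UNIV. \<Sum>i\<in>UNIV. \<Sum>j\<in>UNIV. (e k $ i * e k $ j) *\<^sub>R B (axis i 1) (axis j 1))"
    by (rule sum.swap)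
  also have "\<dots> = (\<Sum>k\<in>UNIV. \<Sum>i\<in>UNIV. e k $ i *\<^sub>R B (axis i 1) (e k))"
    unfolding row ..
  also have "\<dots> = (\<Sum>k\<in>UNIV. B (e k) (e k))"
    by (rule sum.cong[OF refl]) (rule linear_axis_expand[OF B(1), symmetric])
  finally show ?thesis .
qed

sublocale ip: bilinear_field "ip g" S
proof
  show "smooth_on S (\<lambda>y. ip g y p q)" for p q
    unfolding ip_def inner_vec_def matrix_vector_mult_def
    by (auto intro!: smooth_on_sum smooth_on_mult smooth_on_const open_S smooth_g_nth)
qed (auto intro: open_S linear_ip1 linear_ip2)

lemma smooth_christoffel: "smooth_on S (\<lambda>y. christoffel g y u v)"
  unfolding christoffel_def Let_def
  by (rule smooth_on_vec[OF open_S], unfold vec_lambda_beta)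
    (intro smooth_on_sum smooth_on_mult smooth_on_const smooth_on_add smooth_on_diff open_S smooth_matrix_inv
      smooth_on_Der smooth_g_nth)

sublocale chr: bilinear_field "christoffel g" S
  by (rule bilinear_field.intro) (rule open_S linear_christoffel1 linear_christoffel2 smooth_christoffel)+

end

section \<open>The Levi-Civita connection and its curvature in coordinates\<close>

context metric_on
begin

lemma Der_ip_expand:
  assumes x: "x \<in> S"
  shows "Der (\<lambda>y. ip g y v w) x u
    = (\<Sum>i\<in>UNIV. \<Sum>j\<in>UNIV. \<Sum>l\<in>UNIV. Der (\<lambda>y. g y $ j $ l) x (axis i 1) * u $ i * v $ j * w $ l)"
proof -
  have D: "((\<lambda>y. g y $ j $ l) has_derivative Der (\<lambda>y. g y $ j $ l) x) (at x)" for j l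
    by (rule smooth_on_has_Der[OF smooth_g_nth open_S x])
  have eq: "(\<lambda>y. ip g y v w) = (\<lambda>y. \<Sum>j\<in>UNIV. \<Sum>l\<in>UNIV. (v $ j * w $ l) * g y $ j $ l)"
    by (auto simp: ip_def inner_vec_def matrix_vector_mult_def sum_distrib_left algebra_simps)
  have "((\<lambda>y. \<Sum>j\<in>UNIV. \<Sum>l\<in>UNIV. (v $ j * w $ l) * g y $ j $ l) has_derivative
     (\<lambda>u. \<Sum>j\<in>UNIV. \<Sum>l\<in>UNIV. (v $ j * w $ l) * Der (\<lambda>y. g y $ j $ l) x u)) (at x)"
    by (intro has_derivative_sum has_derivative_mult_right D)
  then have "Der (\<lambda>y. ip g y v w) x u = (\<Sum>j\<in>UNIV. \<Sum>l\<in>UNIV. (v $ j * w $ l) * Der (\<lambda>y. g y $ j $ l) x u)"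
    unfolding eq by (rule fun_cong[OF Der_eqI])
  also have "\<dots> = (\<Sum>j\<in>UNIV. \<Sum>l\<in>UNIV. \<Sum>i\<in>UNIV. Der (\<lambda>y. g y $ j $ l) x (axis i 1) * u $ i * v $ j * w $ l)"
    by (subst linear_axis_expand[OF smooth_on_linear_Der[OF smooth_g_nth open_S x]])
      (simp add: sum_distrib_left mult_ac)
  also have "\<dots> = (\<Sum>j\<in>UNIV. \<Sum>i\<in>UNIV. \<Sum>l\<in>UNIV. Der (\<lambda>y. g y $ j $ l) x (axis i 1) * u $ i * v $ j * w $ l)"
    by (rule sum.cong[OF refl], rule sum.swap)
  also have "\<dots> = (\<Sum>i\<in>UNIV. \<Sum>j\<in>UNIV. \<Sum>l\<in>UNIV. Der (\<lambda>y. g y $ j $ l) x (axis i 1) * u $ i * v $ j * w $ l)"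
    by (rule sum.swap)
  finally show ?thesis .
qed

text \<open>Pairing with \<open>w\<close> cancels the inverse metric in the Christoffel symbols. The
  result is Koszul's formula for constant fields, whose brackets vanish; symmetry, metric
  compatibility and the tangential part of the Gauss formula rest on it.\<close>

lemma koszul:
  assumes x: "x \<in> S"
  shows "ip g x (christoffel g x u v) w
    = (Der (\<lambda>y. ip g y v w) x u + Der (\<lambda>y. ip g y u w) x v - Der (\<lambda>y. ip g y u v) x w) / 2"
proof -
  let ?d = "\<lambda>i j l. Der (\<lambda>y. g y $ j $ l) x (axis i 1)"
  \<comment> \<open>Christoffel symbols of the first kind, contracted with \<open>u\<close> and
    \<open>v\<close>.\<close>
  let ?c = "\<chi> l. \<Sum>i\<in>UNIV. \<Sum>j\<in>UNIV. 1 / 2 * (?d i j l + ?d j i l - ?d l i j) * u $ i * v $ j"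
  have "christoffel g x u v $ k = (matrix_inv (g x) *v ?c) $ k" for k
  proof -
    have "(matrix_inv (g x) *v ?c) $ k = (\<Sum>l\<in>UNIV. \<Sum>i\<in>UNIV. \<Sum>j\<in>UNIV.
        matrix_inv (g x) $ k $ l * (1 / 2 * (?d i j l + ?d j i l - ?d l i j) * u $ i * v $ j))"
      by (simp add: matrix_vector_mult_def sum_distrib_left)
    also have "\<dots> = (\<Sum>i\<in>UNIV. \<Sum>l\<in>UNIV. \<Sum>j\<in>UNIV.
        matrix_inv (g x) $ k $ l * (1 / 2 * (?d i j l + ?d j i l - ?d l i j) * u $ i * v $ j))"
      by (rule sum.swap)
    also have "\<dots> = (\<Sum>i\<in>UNIV. \<Sum>j\<in>UNIV. \<Sum>l\<in>UNIV.
        matrix_inv (g x) $ k $ l * (1 / 2 * (?d i j l + ?d j i l - ?d l i j) * u $ i * v $ j))"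
      by (rule sum.cong[OF refl], rule sum.swap)
    also have "\<dots> = christoffel g x u v $ k"
      by (simp add: christoffel_def Let_def sum_distrib_left sum_distrib_right mult_ac)
    finally show ?thesis by simp
  qed
  then have c: "christoffel g x u v = matrix_inv (g x) *v ?c" unfolding vec_eq_iff by blast
  have "ip g x (christoffel g x u v) w = ip g x w (christoffel g x u v)" by (rule ip_sym[OF x])
  also have "\<dots> = w \<bullet> ?c" unfolding c ip_def matrix_inv_g[OF x] ..
  also have "\<dots> = (\<Sum>l\<in>UNIV. \<Sum>i\<in>UNIV. \<Sum>j\<in>UNIV. (?d i j l * u $ i * v $ j * w $ l) / 2)
      + (\<Sum>l\<in>UNIV. \<Sum>i\<in>UNIV. \<Sum>j\<in>UNIV. (?d j i l * v $ j * u $ i * w $ l) / 2)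
      - (\<Sum>l\<in>UNIV. \<Sum>i\<in>UNIV. \<Sum>j\<in>UNIV. (?d l i j * w $ l * u $ i * v $ j) / 2)"
    unfolding sum.distrib[symmetric] sum_subtractf[symmetric]
    by (auto simp: inner_vec_def sum_distrib_left algebra_simps add_divide_distrib diff_divide_distrib
        intro!: sum.cong)
  also have "(\<Sum>l\<in>UNIV. \<Sum>i\<in>UNIV. \<Sum>j\<in>UNIV. (?d i j l * u $ i * v $ j * w $ l) / 2)
      = (\<Sum>i\<in>UNIV. \<Sum>l\<in>UNIV. \<Sum>j\<in>UNIV. (?d i j l * u $ i * v $ j * w $ l) / 2)"
    by (rule sum.swap)
  also have "\<dots> = (\<Sum>i\<in>UNIV. \<Sum>j\<in>UNIV. \<Sum>l\<in>UNIV. (?d i j l * u $ i * v $ j * w $ l) / 2)"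
    by (rule sum.cong[OF refl], rule sum.swap)
  also have "(\<Sum>l\<in>UNIV. \<Sum>i\<in>UNIV. \<Sum>j\<in>UNIV. (?d j i l * v $ j * u $ i * w $ l) / 2)
      = (\<Sum>l\<in>UNIV. \<Sum>j\<in>UNIV. \<Sum>i\<in>UNIV. (?d j i l * v $ j * u $ i * w $ l) / 2)"
    by (rule sum.cong[OF refl], rule sum.swap)
  also have "\<dots> = (\<Sum>j\<in>UNIV. \<Sum>l\<in>UNIV. \<Sum>i\<in>UNIV. (?d j i l * v $ j * u $ i * w $ l) / 2)"
    by (rule sum.swap)
  also have "\<dots> = (\<Sum>j\<in>UNIV. \<Sum>i\<in>UNIV. \<Sum>l\<in>UNIV. (?d j i l * v $ j * u $ i * w $ l) / 2)"
    by (rule sum.cong[OF refl], rule sum.swap)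
  finally show ?thesis
    unfolding Der_ip_expand[OF x] by (simp add: sum_divide_distrib[symmetric] add_divide_distrib diff_divide_distrib)
qed

lemma Der_ip_sym: "x \<in> S \<Longrightarrow> Der (\<lambda>y. ip g y v w) x = Der (\<lambda>y. ip g y w v) x"
  by (rule Der_cong_open[OF open_S]) (auto intro: ip_sym)

lemma christoffel_sym:
  assumes x: "x \<in> S"
  shows "christoffel g x u v = christoffel g x v u"
  by (rule ip_eqI[OF x]) (simp add: koszul[OF x] Der_ip_sym[OF x, of u v])

lemma metric_compat:
  assumes x: "x \<in> S"
  shows "Der (\<lambda>y. ip g y v w) x u = ip g x (christoffel g x u v) w + ip g x v (christoffel g x u w)"
  unfolding ip_sym[OF x, of v] koszul[OF x] Der_ip_sym[OF x, of w v] by (simp add: field_simps)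

lemma nabla_const: "nabla g (\<lambda>_. u) (\<lambda>_. v) x = christoffel g x u v"
  by (simp add: nabla_def covd_def)

lemma curvature_eq:
  assumes x: "x \<in> S"
  shows "curvature g x u v w = Der (\<lambda>y. christoffel g y v w) x u - Der (\<lambda>y. christoffel g y u w) x v
    + christoffel g x u (christoffel g x v w) - christoffel g x v (christoffel g x u w)"
proof -
  have 1: "nabla g (\<lambda>_. a) (\<lambda>_. b) = (\<lambda>x. christoffel g x a b)" for a b
    by (rule ext) (rule nabla_const)
  have 2: "nabla g (\<lambda>_. a) (\<lambda>x. christoffel g x b w) x
    = Der (\<lambda>y. christoffel g y b w) x a + christoffel g x a (christoffel g x b w)" for a b
    by (simp add: nabla_def covd_def)
  have 3: "nabla g (lie_bracket (\<lambda>_. u) (\<lambda>_. v)) (\<lambda>_. w) x = 0"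
    by (simp add: nabla_def covd_def lie_bracket_def linear_0[OF linear_christoffel1])
  show ?thesis
    unfolding curvature_def curvature_field_def 1 2 3 by simp
qed

lemma linear_curvature:
  assumes x: "x \<in> S"
  shows "linear (\<lambda>u. curvature g x u v w)" "linear (\<lambda>v. curvature g x u v w)" "linear (\<lambda>w. curvature g x u v w)"
proof -
  have D: "linear (Der (\<lambda>y. christoffel g y a b) x)" for a b
    by (rule smooth_on_linear_Der[OF smooth_christoffel open_S x])
  note D1 = chr.linear_Der_field1[OF x]
  \<comment> \<open>\<open>linear_Der_field1\<close> concerns the first slot; the symmetry of the
    Christoffel symbols carries it over to the second.\<close>
  have D2: "linear (\<lambda>p. Der (\<lambda>y. christoffel g y q p) x u)" for q u
  proof -
    have "Der (\<lambda>y. christoffel g y q p) x = Der (\<lambda>y. christoffel g y p q) x" for p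
      by (rule Der_cong_open[OF open_S x]) (rule christoffel_sym)
    then show ?thesis using D1[of q u] by simp
  qed
  note C = linear_christoffel1[of g x] linear_christoffel2[of g x]
  note C' = linear_compose[OF C(1) C(2), unfolded o_def] linear_compose[OF C(2) C(2), unfolded o_def]
  show "linear (\<lambda>u. curvature g x u v w)" "linear (\<lambda>v. curvature g x u v w)" "linear (\<lambda>w. curvature g x u v w)"
    unfolding curvature_eq[OF x]
    by (intro linear_compose_add linear_compose_sub D D1 D2 C C')+
qed

lemma curvature_skew12:
  assumes x: "x \<in> S"
  shows "curvature g x u v w = - curvature g x v u w"
  by (simp add: curvature_eq[OF x])

lemma curvature_self:
  assumes x: "x \<in> S"
  shows "curvature g x u u w = 0"
  by (simp add: curvature_eq[OF x])

lemma curvature_bianchi: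
  assumes x: "x \<in> S"
  shows "curvature g x u v w + curvature g x v w u + curvature g x w u v = 0"
proof -
  have D: "Der (\<lambda>y. christoffel g y a b) x = Der (\<lambda>y. christoffel g y b a) x" for a b
    by (rule Der_cong_open[OF open_S x]) (rule christoffel_sym)
  show ?thesis
    unfolding curvature_eq[OF x] D[of v u] D[of w u] D[of w v]
      christoffel_sym[OF x, of v u] christoffel_sym[OF x, of w u] christoffel_sym[OF x, of w v]
    by simp
qed

end

text \<open>The setting of the pull-back connection. With the identity for \<open>F\<close>, as in
  \<open>map_along_id\<close>, its rules become those of the Levi-Civita connection, so both are
  treated at once.\<close>

locale map_along = metric_on h T
  for h :: "real ^ 'n::finite \<Rightarrow> real ^ 'n ^ 'n" and T :: "(real ^ 'n) set" +
  fixes F :: "real ^ 'm::finite \<Rightarrow> real ^ 'n" and S :: "(real ^ 'm) set"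
  assumes open_dom: "open S" and smooth_F: "smooth_on S F" and F_in: "x \<in> S \<Longrightarrow> F x \<in> T"
begin

abbreviation "\<Gamma> \<equiv> christoffel h"
abbreviation "ipF x \<equiv> ip h (F x)"
abbreviation "D \<equiv> covd h F"

lemmas diff = smooth_on_differentiable[OF _ open_dom]
lemmas smooth_DF = smooth_on_Der[OF smooth_F]

lemma F_image: "F ` S \<subseteq> T"
  using F_in by blast

lemma smooth_ip: "smooth_on S V \<Longrightarrow> smooth_on S W \<Longrightarrow> smooth_on S (\<lambda>x. ipF x (V x) (W x))"
  by (rule ip.smooth[OF open_dom smooth_F F_image])

lemma smooth_D: "smooth_on S V \<Longrightarrow> smooth_on S (\<lambda>x. D V x u)"
  unfolding covd_def
  by (intro smooth_on_add open_dom smooth_on_Der chr.smooth[OF open_dom smooth_F F_image] smooth_DF)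

lemma D_cong: "x \<in> S \<Longrightarrow> (\<And>y. y \<in> S \<Longrightarrow> V y = W y) \<Longrightarrow> D V x u = D W x u"
  unfolding covd_def using Der_cong_open[OF open_dom, of x V W] by simp

lemma linear_D:
  assumes x: "x \<in> S" and V: "smooth_on S V"
  shows "linear (D V x)"
  unfolding covd_def
  by (intro linear_compose_add linear_compose[OF smooth_on_linear_Der[OF smooth_F open_dom x] linear_christoffel1, unfolded o_def]
      smooth_on_linear_Der[OF V open_dom x])

lemma D_add:
  assumes x: "x \<in> S" and "smooth_on S V" "smooth_on S W"
  shows "D (\<lambda>y. V y + W y) x u = D V x u + D W x u"
proof -
  have "Der (\<lambda>y. V y + W y) x = (\<lambda>u. Der V x u + Der W x u)"
    by (intro Der_eqI has_derivative_add differentiable_has_Der diff[OF _ x] assms)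
  then show ?thesis by (simp add: covd_def linear_add[OF linear_christoffel2])
qed

lemma D_scale:
  assumes x: "x \<in> S" and "smooth_on S f" "smooth_on S V"
  shows "D (\<lambda>y. f y *\<^sub>R V y) x u = Der f x u *\<^sub>R V x + f x *\<^sub>R D V x u"
proof -
  have "Der (\<lambda>y. f y *\<^sub>R V y) x = (\<lambda>u. f x *\<^sub>R Der V x u + Der f x u *\<^sub>R V x)"
    by (intro Der_eqI has_derivative_scaleR differentiable_has_Der diff[OF _ x] assms)
  then show ?thesis by (simp add: covd_def linear_scale[OF linear_christoffel2] scaleR_add_right)
qed

lemma D_cmul:
  assumes x: "x \<in> S" and "smooth_on S V"
  shows "D (\<lambda>y. c *\<^sub>R V y) x u = c *\<^sub>R D V x u"
  using D_scale[OF x smooth_on_const assms(2), of c] by simp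

text \<open>By \<open>metric_compat\<close>, the derivative of the metric coefficients along
  \<open>F\<close> is exactly the sum of the Christoffel terms in the two covariant
  derivatives.\<close>

lemma D_ip:
  assumes x: "x \<in> S" and "smooth_on S V" "smooth_on S W"
  shows "Der (\<lambda>y. ipF y (V y) (W y)) x u = ipF x (D V x u) (W x) + ipF x (V x) (D W x u)"
  using ip.Der[OF diff[OF smooth_F x] F_in[OF x] diff[OF assms(2) x] diff[OF assms(3) x], of u]
  by (simp add: covd_def metric_compat[OF F_in[OF x]])

lemma D_sym:
  assumes x: "x \<in> S"
  shows "D (\<lambda>y. Der F y v) x u = D (\<lambda>y. Der F y u) x v"
  unfolding covd_def Der_commute[OF smooth_F open_dom x, of v u] christoffel_sym[OF F_in[OF x], of "Der F x u"] ..

text \<open>In the double derivative the second derivatives of \<open>V\<close> and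
  \<open>F\<close>, and the two mixed Christoffel terms together, are symmetric in \<open>u\<close>
  and \<open>v\<close> and cancel; the rest is the coordinate formula \<open>curvature_eq\<close>.
  The directions are constant, so no bracket term arises.\<close>

lemma D_commute:
  assumes x: "x \<in> S" and V: "smooth_on S V"
  shows "D (\<lambda>y. D V y v) x u - D (\<lambda>y. D V y u) x v = curvature h (F x) (Der F x u) (Der F x v) (V x)"
proof -
  have e: "D (\<lambda>y. D V y v) x u = Der (\<lambda>y. Der V y v) x u
     + Der (\<lambda>y. \<Gamma> y (Der F x v) (V x)) (F x) (Der F x u)
     + \<Gamma> (F x) (Der (\<lambda>y. Der F y v) x u) (V x) + \<Gamma> (F x) (Der F x v) (Der V x u)
     + \<Gamma> (F x) (Der F x u) (Der V x v) + \<Gamma> (F x) (Der F x u) (\<Gamma> (F x) (Der F x v) (V x))" for u v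
  proof -
    have "((\<lambda>y. D V y v) has_derivative (\<lambda>u. Der (\<lambda>y. Der V y v) x u + Der (\<lambda>y. \<Gamma> (F y) (Der F y v) (V y)) x u)) (at x)"
      unfolding covd_def
      by (intro has_derivative_add differentiable_has_Der diff[OF _ x] smooth_on_Der V smooth_F
          chr.smooth[OF open_dom smooth_F F_image])
    then have "Der (\<lambda>y. D V y v) x u = Der (\<lambda>y. Der V y v) x u + Der (\<lambda>y. \<Gamma> (F y) (Der F y v) (V y)) x u"
      by (rule fun_cong[OF Der_eqI])
    then show ?thesis
      unfolding covd_def[of h F "\<lambda>y. D V y v"]
      using chr.Der[OF diff[OF smooth_F x] F_in[OF x] diff[OF smooth_DF x] diff[OF V x], of v u]
      by (simp add: covd_def linear_add[OF linear_christoffel2])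
  qed
  show ?thesis
    unfolding e curvature_eq[OF F_in[OF x]] Der_commute[OF V open_dom x, of v u]
      Der_commute[OF smooth_F open_dom x, of v u]
    by simp
qed

end

section \<open>Symmetries of the curvature, Ricci tensor and Laplacian\<close>

context metric_on
begin

lemma map_along_id: "map_along g S (\<lambda>x. x) S"
  by unfold_locales (auto intro: smooth_on_ident open_S)

text \<open>Second derivatives of the function \<open>ip g z w w'\<close> commute. Expanded by the
  product rule in both orders, the cross terms agree, and the remaining difference is curvature by
  \<open>D_commute\<close> along the identity.\<close>

lemma curvature_skew34:
  assumes x: "x \<in> S"
  shows "ip g x (curvature g x u v w) w' = - ip g x (curvature g x u v w') w"
proof -
  interpret I: map_along g S "\<lambda>x. x" S by (rule map_along_id)
  let ?W = "\<lambda>_::real ^ 'm. w" and ?W' = "\<lambda>_::real ^ 'm. w'"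
  note c = smooth_on_const[of S w] smooth_on_const[of S w']
  have e: "Der (\<lambda>y. Der (\<lambda>z. ip g z w w') y v) x u
     = ip g x (I.D (\<lambda>y. I.D ?W y v) x u) w' + ip g x (I.D ?W x v) (I.D ?W' x u)
     + (ip g x (I.D ?W x u) (I.D ?W' x v) + ip g x w (I.D (\<lambda>y. I.D ?W' y v) x u))" for u v
  proof -
    have "Der (\<lambda>y. Der (\<lambda>z. ip g z w w') y v) x u
        = Der (\<lambda>y. ip g y (I.D ?W y v) w' + ip g y w (I.D ?W' y v)) x u"
      by (rule fun_cong[OF Der_cong_open[OF open_S x]]) (rule I.D_ip[OF _ c])
    also have "\<dots> = Der (\<lambda>y. ip g y (I.D ?W y v) w') x u + Der (\<lambda>y. ip g y w (I.D ?W' y v)) x u"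
      by (rule fun_cong[OF Der_eqI])
        (intro has_derivative_add differentiable_has_Der I.diff[OF _ x] I.smooth_ip I.smooth_D c)
    also have "\<dots> = ip g x (I.D (\<lambda>y. I.D ?W y v) x u) w' + ip g x (I.D ?W x v) (I.D ?W' x u)
     + (ip g x (I.D ?W x u) (I.D ?W' x v) + ip g x w (I.D (\<lambda>y. I.D ?W' y v) x u))"
      using I.D_ip[OF x I.smooth_D[OF c(1)] c(2)] I.D_ip[OF x c(1) I.smooth_D[OF c(2)]] by simp
    finally show ?thesis .
  qed
  have "Der (\<lambda>y. Der (\<lambda>z. ip g z w w') y v) x u = Der (\<lambda>y. Der (\<lambda>z. ip g z w w') y u) x v"
    by (rule Der_commute[OF ip.smooth_B open_S x])
  then have "ip g x (I.D (\<lambda>y. I.D ?W y v) x u - I.D (\<lambda>y. I.D ?W y u) x v) w'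
      + ip g x w (I.D (\<lambda>y. I.D ?W' y v) x u - I.D (\<lambda>y. I.D ?W' y u) x v) = 0"
    unfolding e by simp
  then show ?thesis
    unfolding I.D_commute[OF x c(1)] I.D_commute[OF x c(2)] ip_sym[OF x, of w] by simp
qed

lemma curvature_pair_sym:
  assumes x: "x \<in> S"
  shows "ip g x (curvature g x a b c) d = ip g x (curvature g x c d a) b"
proof -
  define K where "K = (\<lambda>a b c d. ip g x (curvature g x a b c) d)"
  have 1: "K a b c d = - K b a c d" for a b c d
    unfolding K_def by (subst curvature_skew12[OF x]) simp
  have 2: "K a b c d = - K a b d c" for a b c d
    unfolding K_def by (rule curvature_skew34[OF x])
  have 3: "K a b c d + K b c a d + K c a b d = 0" for a b c d
    unfolding K_def using curvature_bianchi[OF x, of a b c] by (simp flip: ip_simps(1))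
  \<comment> \<open>The classical combination of four cyclic Bianchi identities: the two skew
    symmetries identify terms that agree up to sign, and the rest is linear arithmetic.\<close>
  have "K a b c d = K c d a b"
    using 3[of a b c d] 3[of b c d a] 3[of c d a b] 3[of d a b c]
      1[of a b] 1[of b c] 1[of c a] 1[of c d] 1[of d b] 1[of d a] 1[of a c] 1[of b d]
      2[of a b] 2[of b c] 2[of c a] 2[of c d] 2[of d b] 2[of d a] 2[of a c] 2[of b d]
    by smt
  then show ?thesis by (simp add: K_def)
qed

lemma linear_ricci:
  assumes x: "x \<in> S"
  shows "linear (ricci g x u)"
proof -
  obtain e where e: "orthonormal_frame g x e" using orthonormal_frame_exists[OF x] by blast
  have "ricci g x u = (\<lambda>v. \<Sum>i\<in>UNIV. ip g x (curvature g x (e i) u v) (e i))"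
    unfolding ricci_def by (rule ext, rule frame_trace[OF x e linear_curvature(1)[OF x]])
  moreover have "linear (\<lambda>v. \<Sum>i\<in>UNIV. ip g x (curvature g x (e i) u v) (e i))"
    using linear_curvature(3)[OF x] linear_ip1
    by (intro linear_compose_sum ballI linear_compose[of "\<lambda>v. curvature g x _ u v" "\<lambda>z. ip g x z _", unfolded o_def])
  ultimately show ?thesis by simp
qed

lemma ricci_sym:
  assumes x: "x \<in> S"
  shows "ricci g x u v = ricci g x v u"
proof -
  obtain e where e: "orthonormal_frame g x e" using orthonormal_frame_exists[OF x] by blast
  have r: "ricci g x u v = (\<Sum>i\<in>UNIV. ip g x (curvature g x (e i) u v) (e i))" for u v
    unfolding ricci_def by (rule frame_trace[OF x e linear_curvature(1)[OF x]])
  have "ip g x (curvature g x a u v) a = ip g x (curvature g x a v u) a" for a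
    using curvature_pair_sym[OF x, of a u v a] curvature_skew12[OF x, of v a a]
      curvature_skew34[OF x, of a v a u] by simp
  then show ?thesis unfolding r by simp
qed

lemma ip_ricci_op: "x \<in> S \<Longrightarrow> ip g x (ricci_op g x u) v = ricci g x u v"
  unfolding ricci_op_def by (rule ip_sharp[OF _ linear_ricci])

lemma ip_grad: "x \<in> S \<Longrightarrow> f differentiable (at x) \<Longrightarrow> ip g x (grad g f x) v = Der f x v"
  unfolding grad_def by (rule ip_sharp[OF _ linear_Der])

lemma smooth_grad: "smooth_on S f \<Longrightarrow> smooth_on S (grad g f)"
  using smooth_sharp[of S "Der f"] smooth_on_linear_Der[OF _ open_S] smooth_on_Der open_S
  unfolding grad_def[abs_def] by blast

text \<open>The Laplacian is the trace of the covariant derivative of the gradient, whose pairings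
  form the Hessian. The \<open>e i\<close> are extended constantly rather than parallelly, which
  accounts for the Christoffel term.\<close>

lemma laplacian_frame:
  assumes x: "x \<in> S" and f: "smooth_on S f" and e: "orthonormal_frame g x e"
  shows "laplacian g f x
    = (\<Sum>i\<in>UNIV. Der (\<lambda>y. Der f y (e i)) x (e i) - Der f x (christoffel g x (e i) (e i)))"
proof -
  interpret I: map_along g S "\<lambda>x. x" S by (rule map_along_id)
  note sg = smooth_grad[OF f]
  have hess: "ip g x (I.D (grad g f) x u) v = Der (\<lambda>y. Der f y v) x u - Der f x (christoffel g x u v)" for u v
  proof -
    have "Der (\<lambda>y. Der f y v) x u = Der (\<lambda>y. ip g y (grad g f y) v) x u"
      by (rule fun_cong[OF Der_cong_open[OF open_S x]])
        (simp add: ip_grad I.diff[OF f])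
    also have "\<dots> = ip g x (I.D (grad g f) x u) v + ip g x (grad g f x) (christoffel g x u v)"
      using I.D_ip[OF x sg smooth_on_const, of v u] by (simp add: covd_def)
    finally show ?thesis by (simp add: ip_grad[OF x I.diff[OF f x]])
  qed
  have "laplacian g f x = trace (matrix (I.D (grad g f) x))"
    unfolding laplacian_def divergence_def nabla_def ..
  also have "\<dots> = (\<Sum>i\<in>UNIV. ip g x (I.D (grad g f) x (e i)) (e i))"
    by (rule frame_trace[OF x e I.linear_D[OF x sg]])
  finally show ?thesis by (simp only: hess)
qed

end

section \<open>Hypersurfaces in coordinates\<close>

context map_along
begin

text \<open>\<open>frame_trace_g\<close> asks for bilinearity; this supplies linearity in the
  argument that sits inside the differentiated field.\<close>

lemma linear_D_of_linear:
  assumes x: "x \<in> S" and V: "\<And>v. smooth_on S (\<lambda>y. V y v)" "\<And>y. y \<in> S \<Longrightarrow> linear (V y)"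
  shows "linear (\<lambda>v. D (\<lambda>y. V y v) x u)"
proof (rule linearI)
  show "D (\<lambda>y. V y (v + w)) x u = D (\<lambda>y. V y v) x u + D (\<lambda>y. V y w) x u" for v w
    using D_cong[OF x, of "\<lambda>y. V y (v + w)" "\<lambda>y. V y v + V y w"] D_add[OF x V(1) V(1)] linear_add[OF V(2)]
    by simp
  show "D (\<lambda>y. V y (c *\<^sub>R v)) x u = c *\<^sub>R D (\<lambda>y. V y v) x u" for c v
    using D_cong[OF x, of "\<lambda>y. V y (c *\<^sub>R v)" "\<lambda>y. c *\<^sub>R V y v"] D_cmul[OF x V(1)] linear_scale[OF V(2)]
    by simp
qed

lemma linear_D_DF: "x \<in> S \<Longrightarrow> linear (\<lambda>v. D (\<lambda>y. Der F y v) x u)"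
  by (rule linear_D_of_linear) (auto intro: smooth_DF smooth_on_linear_Der[OF smooth_F open_dom])

end

text \<open>The data available before a normal is chosen; \<open>local_unit_normal\<close>
  constructs the normal from them.\<close>

locale isometric_codim1 = map_along h T F S + M: metric_on g S
  for h :: "real ^ 'n::finite \<Rightarrow> real ^ 'n ^ 'n" and T and F :: "real ^ 'm::finite \<Rightarrow> real ^ 'n" and S
    and g :: "real ^ 'm \<Rightarrow> real ^ 'm ^ 'm" +
  assumes codim1: "CARD('n) = CARD('m) + 1"
    and isometric: "x \<in> S \<Longrightarrow> ip h (F x) (Der F x u) (Der F x v) = ip g x u v"
begin

lemma linear_DF: "x \<in> S \<Longrightarrow> linear (Der F x)"
  by (rule smooth_on_linear_Der[OF smooth_F open_dom])

lemma ipF_sym: "x \<in> S \<Longrightarrow> ipF x u v = ipF x v u"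
  by (rule ip_sym[OF F_in])

text \<open>Differentiating the isometry condition expresses the derivatives of \<open>g\<close> by
  covariant derivatives of \<open>Der F\<close>; in Koszul's combination all but one pair of them
  cancel by \<open>D_sym\<close>.\<close>

lemma D_DF_tangential:
  assumes x: "x \<in> S"
  shows "ipF x (D (\<lambda>y. Der F y v) x u) (Der F x w) = ip g x (christoffel g x u v) w"
proof -
  have *: "Der (\<lambda>y. ip g y v w) x u
      = ipF x (D (\<lambda>y. Der F y v) x u) (Der F x w) + ipF x (D (\<lambda>y. Der F y w) x u) (Der F x v)" for u v w
  proof -
    have "Der (\<lambda>y. ip g y v w) x u = Der (\<lambda>y. ipF y (Der F y v) (Der F y w)) x u"
      by (rule fun_cong[OF Der_cong_open[OF open_dom x]]) (simp add: isometric)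
    then show ?thesis
      using D_ip[OF x smooth_DF smooth_DF, of v w u] ipF_sym[OF x, of "Der F x v"] by simp
  qed
  show ?thesis
    unfolding M.koszul[OF x] * D_sym[OF x, of w u] D_sym[OF x, of w v] D_sym[OF x, of u v] by simp
qed

end

section \<open>Second fundamental form and the equations of Gauss, Weingarten and Codazzi\<close>

locale hypersurface = isometric_codim1 h T F S g
  for h :: "real ^ 'n::finite \<Rightarrow> real ^ 'n ^ 'n" and T and F :: "real ^ 'm::finite \<Rightarrow> real ^ 'n" and S
    and g :: "real ^ 'm \<Rightarrow> real ^ 'm ^ 'm" +
  fixes \<nu> :: "real ^ 'm \<Rightarrow> real ^ 'n"
  assumes smooth_\<nu>: "smooth_on S \<nu>"
    and unit: "x \<in> S \<Longrightarrow> ip h (F x) (\<nu> x) (\<nu> x) = 1"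
    and normal: "x \<in> S \<Longrightarrow> ip h (F x) (\<nu> x) (Der F x v) = 0"
begin

abbreviation "b \<equiv> second_form h F \<nu>"
abbreviation "A \<equiv> shape_op g h F \<nu>"
abbreviation "H \<equiv> mean_curvature g h F \<nu>"

lemma normal': "x \<in> S \<Longrightarrow> ipF x (Der F x v) (\<nu> x) = 0"
  using normal ipF_sym by metis

text \<open>Pairing with the normal and with the tangent part shows that (a, s) is determined by
  \<open>Der F x a + s *\<^sub>R \<nu> x\<close>; since the codimension is one, injectivity gives
  surjectivity by counting dimensions.\<close>

lemma tangent_normal_decomp:
  assumes x: "x \<in> S"
  shows "\<exists>a s. W = Der F x a + s *\<^sub>R \<nu> x"
proof -
  define L where "L = (\<lambda>p :: (real ^ 'm) \<times> real. Der F x (fst p) + snd p *\<^sub>R \<nu> x)"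
  have lin: "linear L"
    unfolding L_def
    by (rule linearI) (auto simp: linear_add[OF linear_DF[OF x]] linear_scale[OF linear_DF[OF x]] algebra_simps)
  have "p = 0" if "L p = 0" for p
  proof -
    have "ipF x (L p) (\<nu> x) = snd p" by (simp add: L_def normal'[OF x] unit[OF x])
    moreover have "ipF x (L p) (Der F x (fst p)) = ip g x (fst p) (fst p)"
      by (simp add: L_def normal[OF x] isometric[OF x])
    ultimately show ?thesis
      using that M.ip_pos[OF x, of "fst p"] by (cases "fst p = 0") (auto simp: prod_eq_iff)
  qed
  then have "inj L" using linear_injective_0[OF lin] by blast
  then have "dim (range L) = DIM(real ^ 'n)"
    using dim_image_eq[OF lin, of UNIV] codim1 by simp
  then have "span (range L) = UNIV" using dim_eq_full by blast
  then have "range L = UNIV"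
    using span_eq_iff[of "range L"] linear_subspace_image[OF lin subspace_UNIV] by simp
  then obtain p where "W = L p" by (metis rangeE UNIV_I)
  then show ?thesis unfolding L_def by blast
qed

lemma zero_iff_components:
  assumes x: "x \<in> S"
  shows "W = 0 \<longleftrightarrow> ipF x W (\<nu> x) = 0 \<and> (\<forall>w. ipF x W (Der F x w) = 0)"
proof
  assume *: "ipF x W (\<nu> x) = 0 \<and> (\<forall>w. ipF x W (Der F x w) = 0)"
  show "W = 0"
  proof (rule ip_eqI[OF F_in[OF x]])
    fix V
    obtain a s where "V = Der F x a + s *\<^sub>R \<nu> x" using tangent_normal_decomp[OF x] by blast
    then show "ip h (F x) W V = ip h (F x) 0 V" using * by simp
  qed
qed simp

lemma eq_components:
  assumes x: "x \<in> S" and "ipF x V (\<nu> x) = ipF x W (\<nu> x)" "\<And>w. ipF x V (Der F x w) = ipF x W (Der F x w)"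
  shows "V = W"
  using zero_iff_components[OF x, of "V - W"] assms(2,3) by simp

lemma adapted_frame_trace:
  assumes x: "x \<in> S" and e: "orthonormal_frame g x e" and L: "linear L"
  shows "trace (matrix L) = (\<Sum>i\<in>UNIV. ipF x (L (Der F x (e i))) (Der F x (e i))) + ipF x (L (\<nu> x)) (\<nu> x)"
proof -
  \<comment> \<open>The adapted orthonormal frame of the ambient space, indexed by
    \<open>'m option\<close> with \<open>None\<close> for the normal.\<close>
  define E where "E = case_option (\<nu> x) (\<lambda>i. Der F x (e i))"
  have sum_E: "(\<Sum>a\<in>UNIV. f (E a)) = f (\<nu> x) + (\<Sum>i\<in>UNIV. f (Der F x (e i)))" for f :: "real ^ 'n \<Rightarrow> 'z::real_vector"
    unfolding UNIV_option_conv by (simp add: sum.reindex E_def)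
  have "W = (\<Sum>a\<in>UNIV. ipF x W (E a) *\<^sub>R E a)" for W
  proof -
    obtain a s where W: "W = Der F x a + s *\<^sub>R \<nu> x" using tangent_normal_decomp[OF x] by blast
    have "Der F x a = (\<Sum>i\<in>UNIV. ip g x a (e i) *\<^sub>R Der F x (e i))"
      using arg_cong[OF M.frame_expand[OF x e, of a], of "Der F x"]
      by (simp add: linear_sum[OF linear_DF[OF x]] linear_scale[OF linear_DF[OF x]])
    moreover have "ipF x W (\<nu> x) = s" "ipF x W (Der F x u) = ip g x a u" for u
      by (simp_all add: W normal[OF x] normal'[OF x] unit[OF x] isometric[OF x])
    ultimately have "(\<Sum>a\<in>UNIV. ipF x W (E a) *\<^sub>R E a) = s *\<^sub>R \<nu> x + Der F x a"
      unfolding sum_E[of "\<lambda>E. ipF x W E *\<^sub>R E"] by simp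
    then show ?thesis by (simp add: W)
  qed
  from trace_matrix_expansion[OF L this] show ?thesis
    using sum_E[of "\<lambda>E. ipF x (L E) E"] by simp
qed

lemma linear_b1: "x \<in> S \<Longrightarrow> linear (\<lambda>u. b x u v)"
  unfolding second_form_def
  by (rule linear_compose[OF linear_D[OF _ smooth_DF] linear_ip1, unfolded o_def])

lemma linear_b2: "x \<in> S \<Longrightarrow> linear (b x u)"
  using linear_compose[OF linear_D_DF linear_ip1, unfolded o_def]
  unfolding second_form_def[abs_def] by blast

lemma b_sym: "x \<in> S \<Longrightarrow> b x u v = b x v u"
  unfolding second_form_def by (simp add: D_sym[of x u v])

lemma smooth_b: "smooth_on S (\<lambda>y. b y u v)"
  unfolding second_form_def by (intro smooth_ip smooth_D smooth_DF smooth_\<nu>)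

lemma ip_A: "x \<in> S \<Longrightarrow> ip g x (A x u) v = b x u v"
  unfolding shape_op_def by (rule M.ip_sharp[OF _ linear_b2])

lemma linear_A: "x \<in> S \<Longrightarrow> linear (A x)"
  by (rule linearI; rule M.ip_eqI)
    (auto simp: ip_A linear_add[OF linear_b1] linear_scale[OF linear_b1])

lemma smooth_A: "smooth_on S (\<lambda>y. A y u)"
  unfolding shape_op_def
  by (rule M.smooth_sharp) (auto intro: open_dom linear_b2 smooth_b)

lemma D_DF_normal: "ipF x (D (\<lambda>y. Der F y v) x u) (\<nu> x) = b x u v"
  by (simp add: second_form_def)

lemma gauss_formula:
  assumes x: "x \<in> S"
  shows "D (\<lambda>y. Der F y v) x u = Der F x (christoffel g x u v) + b x u v *\<^sub>R \<nu> x"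
  by (rule eq_components[OF x])
    (simp_all add: D_DF_normal D_DF_tangential[OF x] normal[OF x] normal'[OF x] unit[OF x] isometric[OF x])

text \<open>The constant length of the normal is differentiated; \<open>D_\<nu>_tangential\<close>
  comes in the same way from its orthogonality to the image of \<open>Der F\<close>.\<close>

lemma D_\<nu>_normal:
  assumes x: "x \<in> S"
  shows "ipF x (D \<nu> x u) (\<nu> x) = 0"
proof -
  have "Der (\<lambda>y. ipF y (\<nu> y) (\<nu> y)) x u = Der (\<lambda>_. 1) x u"
    by (rule fun_cong[OF Der_cong_open[OF open_dom x]]) (simp add: unit)
  then show ?thesis
    using D_ip[OF x smooth_\<nu> smooth_\<nu>, of u] ipF_sym[OF x, of "\<nu> x" "D \<nu> x u"] by simp
qed

lemma D_\<nu>_tangential: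
  assumes x: "x \<in> S"
  shows "ipF x (D \<nu> x u) (Der F x v) = - b x u v"
proof -
  have "Der (\<lambda>y. ipF y (\<nu> y) (Der F y v)) x u = Der (\<lambda>_. 0) x u"
    by (rule fun_cong[OF Der_cong_open[OF open_dom x]]) (simp add: normal)
  then show ?thesis
    using D_ip[OF x smooth_\<nu> smooth_DF, of v u] ipF_sym[OF x, of "\<nu> x"] by (simp add: D_DF_normal)
qed

lemma weingarten_formula:
  assumes x: "x \<in> S"
  shows "D \<nu> x u = - Der F x (A x u)"
  by (rule eq_components[OF x])
    (simp_all add: D_\<nu>_normal[OF x] D_\<nu>_tangential[OF x] normal'[OF x] isometric[OF x] ip_A[OF x])

lemma trace_A: "trace (matrix (A x)) = real CARD('m) * H x"
  by (simp add: mean_curvature_def)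

lemma smooth_H: "smooth_on S H"
  unfolding mean_curvature_def[abs_def] trace_def matrix_def vec_lambda_beta
  by (intro smooth_on_mult smooth_on_sum smooth_on_nth smooth_on_const smooth_A open_dom)

text \<open>By the Gauss formula, the tangential part of the derivative of \<open>Der F\<close>
  cancels in \<open>nabla_dF\<close>, which leaves \<open>b\<close> times the normal.\<close>

lemma tension_eq:
  assumes x: "x \<in> S"
  shows "tension g h F x = real CARD('m) *\<^sub>R (H x *\<^sub>R \<nu> x)"
proof -
  obtain e where e: "orthonormal_frame g x e" using M.orthonormal_frame_exists[OF x] by blast
  have "nabla_dF g h F x u v = b x u v *\<^sub>R \<nu> x" for u v
    unfolding nabla_dF_def M.nabla_const gauss_formula[OF x] by simp
  then have "nabla_dF g h F x = (\<lambda>u v. b x u v *\<^sub>R \<nu> x)" by (intro ext)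
  then have "tension g h F x = trace_g g x (\<lambda>u v. b x u v *\<^sub>R \<nu> x)" by (simp add: tension_def)
  also have "\<dots> = (\<Sum>i\<in>UNIV. b x (e i) (e i) *\<^sub>R \<nu> x)"
    by (rule M.frame_trace_g[OF x e]; rule linearI)
      (simp_all add: linear_add[OF linear_b1[OF x]] linear_add[OF linear_b2[OF x]]
        linear_scale[OF linear_b1[OF x]] linear_scale[OF linear_b2[OF x]] scaleR_add_left)
  also have "\<dots> = trace (matrix (A x)) *\<^sub>R \<nu> x"
    by (simp add: M.frame_trace[OF x e linear_A[OF x]] ip_A[OF x] scaleR_sum_left)
  finally show ?thesis by (simp add: trace_A)
qed

text \<open>The covariant derivative \<open>(\<nabla>\<^sub>u b)(v, w)\<close> of the second
  fundamental form, evaluated on constant-coefficient fields.\<close>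

definition Db :: "real ^ 'm \<Rightarrow> real ^ 'm \<Rightarrow> real ^ 'm \<Rightarrow> real ^ 'm \<Rightarrow> real" where
  "Db x u v w = Der (\<lambda>y. b y v w) x u - b x (christoffel g x u v) w - b x v (christoffel g x u w)"

lemma Db_sym:
  assumes x: "x \<in> S"
  shows "Db x u v w = Db x u w v"
proof -
  have "Der (\<lambda>y. b y v w) x = Der (\<lambda>y. b y w v) x"
    by (rule Der_cong_open[OF open_dom x]) (rule b_sym)
  then show ?thesis
    unfolding Db_def using b_sym[OF x, of v] b_sym[OF x, of w] by simp
qed

text \<open>Besides a second covariant derivative of \<open>Der F\<close>, the derivative of
  \<open>b\<close> contributes only Christoffel terms that together are symmetric in
  \<open>u\<close> and \<open>w\<close>. The difference is thus a commutator of covariant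
  derivatives, hence curvature.\<close>

lemma codazzi:
  assumes x: "x \<in> S"
  shows "Db x u w v - Db x w u v = ipF x (curvature h (F x) (Der F x u) (Der F x w) (Der F x v)) (\<nu> x)"
proof -
  have e: "Db x u w v = ipF x (D (\<lambda>y. D (\<lambda>y. Der F y v) y w) x u) (\<nu> x)
     - b x u (christoffel g x w v) - b x (christoffel g x u w) v - b x w (christoffel g x u v)" for u w
  proof -
    have "Der (\<lambda>y. b y w v) x u = ipF x (D (\<lambda>y. D (\<lambda>y. Der F y v) y w) x u) (\<nu> x)
        + ipF x (D (\<lambda>y. Der F y v) x w) (D \<nu> x u)"
      unfolding second_form_def by (rule D_ip[OF x smooth_D[OF smooth_DF] smooth_\<nu>])
    \<comment> \<open>The derivative of the normal is tangential and sees only the tangential part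
      in the Gauss formula.\<close>
    also have "ipF x (D (\<lambda>y. Der F y v) x w) (D \<nu> x u) = - b x u (christoffel g x w v)"
      unfolding gauss_formula[OF x] ipF_sym[OF x, of _ "D \<nu> x u"]
      by (simp add: D_\<nu>_normal[OF x] D_\<nu>_tangential[OF x])
    finally show ?thesis by (simp add: Db_def)
  qed
  have "Db x u w v - Db x w u v = ipF x (D (\<lambda>y. D (\<lambda>y. Der F y v) y w) x u - D (\<lambda>y. D (\<lambda>y. Der F y v) y u) x w) (\<nu> x)"
    unfolding e M.christoffel_sym[OF x, of w u] by simp
  then show ?thesis unfolding D_commute[OF x smooth_DF] .
qed

text \<open>The bilinear form \<open>Db x w\<close> belongs to the endomorphism \<open>\<partial>\<^sub>w A + [\<Gamma>\<^sub>w, A]\<close>, and the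
  commutator has trace zero. This avoids differentiating the inverse metric.\<close>

lemma trace_Db:
  assumes x: "x \<in> S" and e: "orthonormal_frame g x e"
  shows "(\<Sum>i\<in>UNIV. Db x w (e i) (e i)) = real CARD('m) * Der H x w"
proof -
  interpret I: map_along g S "\<lambda>x. x" S by (rule M.map_along_id)
  let ?\<Gamma> = "christoffel g x w"
  let ?dA = "\<lambda>u. Der (\<lambda>y. A y u) x w"
  let ?L = "\<lambda>u. ?dA u + (?\<Gamma> (A x u) - A x (?\<Gamma> u))"
  have dA: "((\<lambda>y. A y u) has_derivative Der (\<lambda>y. A y u) x) (at x)" for u
    by (rule smooth_on_has_Der[OF smooth_A open_dom x])
  have "linear ?dA"
  proof (rule linearI)
    have "Der (\<lambda>y. A y (u + v)) x = Der (\<lambda>y. A y u + A y v) x" for u v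
      by (rule Der_cong_open[OF open_dom x]) (simp add: linear_add[OF linear_A])
    then show "?dA (u + v) = ?dA u + ?dA v" for u v
      using fun_cong[OF Der_eqI[OF has_derivative_add[OF dA dA]]] by simp
    have "Der (\<lambda>y. A y (c *\<^sub>R u)) x = Der (\<lambda>y. c *\<^sub>R A y u) x" for c u
      by (rule Der_cong_open[OF open_dom x]) (simp add: linear_scale[OF linear_A])
    then show "?dA (c *\<^sub>R u) = c *\<^sub>R ?dA u" for c u
      using fun_cong[OF Der_eqI[OF has_derivative_scaleR_right[OF dA]]] by simp
  qed
  then have L: "linear ?L"
    using linear_compose[OF linear_A[OF x] linear_christoffel2[of g x w]]
      linear_compose[OF linear_christoffel2[of g x w] linear_A[OF x]]
    by (intro linear_compose_add linear_compose_sub) (auto simp: o_def)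
  have Db: "Db x w u v = ip g x (?L u) v" for u v
  proof -
    have "Der (\<lambda>y. b y u v) x w = Der (\<lambda>y. ip g y (A y u) v) x w"
      by (rule fun_cong[OF Der_cong_open[OF open_dom x]]) (simp add: ip_A)
    also have "\<dots> = ip g x (?dA u + ?\<Gamma> (A x u)) v + ip g x (A x u) (?\<Gamma> v)"
      using I.D_ip[OF x smooth_A smooth_on_const, of u v w] by (simp add: covd_def)
    finally show ?thesis by (simp add: Db_def ip_A[OF x])
  qed
  have "trace (matrix ?L) = trace (matrix ?dA) + (trace (matrix (\<lambda>u. ?\<Gamma> (A x u))) - trace (matrix (\<lambda>u. A x (?\<Gamma> u))))"
    by (simp add: trace_def matrix_def sum.distrib sum_subtractf)
  also have "\<dots> = trace (matrix ?dA)"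
    using trace_matrix_commutator[OF linear_christoffel2[of g x w] linear_A[OF x]] by simp
  \<comment> \<open>Matrix entries refer to the constant coordinate basis, so the trace is
    differentiated entrywise.\<close>
  also have "\<dots> = Der (\<lambda>y. \<Sum>j\<in>UNIV. A y (axis j 1) $ j) x w"
    by (subst Der_eqI[OF has_derivative_sum[OF bounded_linear.has_derivative[OF bounded_linear_vec_nth dA]]])
      (simp add: trace_def matrix_def)
  also have "(\<lambda>y. \<Sum>j\<in>UNIV. A y (axis j 1) $ j) = (\<lambda>y. real CARD('m) * H y)"
    using trace_A by (simp add: trace_def matrix_def)
  also have "Der \<dots> x w = real CARD('m) * Der H x w"
    by (rule Der_linear[OF bounded_linear_mult_right diff[OF smooth_H x]])
  finally show ?thesis
    unfolding Db by (simp add: M.frame_trace[OF x e L])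
qed

text \<open>Differentiating \<open>D_\<nu>_tangential\<close> gives one Christoffel correction of
  \<open>b\<close> through the Gauss formula; the subtracted derivative of the normal gives the
  other one, which completes \<open>Db\<close>.\<close>

lemma second_D_\<nu>_tangential:
  assumes x: "x \<in> S"
  shows "ipF x (D (\<lambda>y. D \<nu> y v) x u - D \<nu> x (christoffel g x u v)) (Der F x w) = - Db x u v w"
proof -
  have "Der (\<lambda>y. b y v w) x u = Der (\<lambda>y. - ipF y (D \<nu> y v) (Der F y w)) x u"
    by (rule fun_cong[OF Der_cong_open[OF open_dom x]]) (simp add: D_\<nu>_tangential)
  also have "\<dots> = - Der (\<lambda>y. ipF y (D \<nu> y v) (Der F y w)) x u"
    by (rule Der_linear[OF bounded_linear_minus[OF bounded_linear_ident]])
      (intro diff[OF _ x] smooth_ip smooth_D smooth_\<nu> smooth_DF)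
  also have "Der (\<lambda>y. ipF y (D \<nu> y v) (Der F y w)) x u
      = ipF x (D (\<lambda>y. D \<nu> y v) x u) (Der F x w) + ipF x (D \<nu> x v) (D (\<lambda>y. Der F y w) x u)"
    by (rule D_ip[OF x smooth_D[OF smooth_\<nu>] smooth_DF])
  finally show ?thesis
    by (simp add: Db_def gauss_formula[OF x] D_\<nu>_normal[OF x] D_\<nu>_tangential[OF x])
qed

text \<open>Differentiating the orthogonality of \<open>D \<nu>\<close> and \<open>\<nu>\<close>
  trades the second derivative for a product of first derivatives, that is, of values of the shape
  operator. Its trace produces \<open>|A|\<^sup>2\<close>.\<close>

lemma second_D_\<nu>_normal:
  assumes x: "x \<in> S"
  shows "ipF x (D (\<lambda>y. D \<nu> y v) x u - D \<nu> x (christoffel g x u v)) (\<nu> x) = - ip g x (A x u) (A x v)"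
proof -
  have "Der (\<lambda>y. ipF y (D \<nu> y v) (\<nu> y)) x u = Der (\<lambda>_. 0) x u"
    by (rule fun_cong[OF Der_cong_open[OF open_dom x]]) (simp add: D_\<nu>_normal)
  then have "ipF x (D (\<lambda>y. D \<nu> y v) x u) (\<nu> x) + ipF x (D \<nu> x v) (D \<nu> x u) = 0"
    using D_ip[OF x smooth_D[OF smooth_\<nu>] smooth_\<nu>, of v u] by simp
  then show ?thesis
    using M.ip_sym[OF x, of "A x u"]
    by (simp add: D_\<nu>_normal[OF x] weingarten_formula[OF x, of u] weingarten_formula[OF x, of v] isometric[OF x])
qed

section \<open>The bitension field and its normal and tangential components\<close>

lemma ricci_frame:
  assumes x: "x \<in> S" and e: "orthonormal_frame g x e"
  shows "ricci h (F x) u v = (\<Sum>i\<in>UNIV. ipF x (curvature h (F x) (Der F x (e i)) u v) (Der F x (e i)))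
     + ipF x (curvature h (F x) (\<nu> x) u v) (\<nu> x)"
  unfolding ricci_def by (rule adapted_frame_trace[OF x e linear_curvature(1)[OF F_in[OF x]]])

text \<open>On the diagonal the two mixed terms of the Leibniz rule coincide, whence the factor 2.
  The single subtracted derivative in \<open>bitension\<close> splits into the Christoffel
  corrections for \<open>H\<close> and for the normal.\<close>

lemma bitension_frame:
  assumes x: "x \<in> S" and e: "orthonormal_frame g x e"
  shows "bitension g h F x = real CARD('m) *\<^sub>R (\<Sum>i\<in>UNIV.
      (Der (\<lambda>y. Der H y (e i)) x (e i) - Der H x (christoffel g x (e i) (e i))) *\<^sub>R \<nu> x
      + (2 * Der H x (e i)) *\<^sub>R D \<nu> x (e i)
      + H x *\<^sub>R (D (\<lambda>y. D \<nu> y (e i)) x (e i) - D \<nu> x (christoffel g x (e i) (e i)))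
      - H x *\<^sub>R curvature h (F x) (Der F x (e i)) (\<nu> x) (Der F x (e i)))"
proof -
  define V where "V = (\<lambda>y. real CARD('m) *\<^sub>R (H y *\<^sub>R \<nu> y))"
  have Vx: "V x = real CARD('m) *\<^sub>R (H x *\<^sub>R \<nu> x)" by (simp add: V_def)
  have sH\<nu>: "smooth_on S (\<lambda>y. H y *\<^sub>R \<nu> y)" by (intro smooth_on_scaleR open_dom smooth_H smooth_\<nu>)
  have sV: "smooth_on S V" unfolding V_def by (intro smooth_on_scaleR open_dom smooth_on_const sH\<nu>)
  \<comment> \<open>\<open>tension_eq\<close> holds on the open set \<open>S\<close> only, which is
    enough to replace the field under one and then under two covariant derivatives.\<close>
  have tau: "D (tension g h F) y v = D V y v" if "y \<in> S" for y v
    by (rule D_cong[OF that]) (simp add: tension_eq V_def)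
  have tau2: "D (\<lambda>y. D (tension g h F) y v) x u = D (\<lambda>y. D V y v) x u" for u v
    by (rule D_cong[OF x]) (rule tau)
  have DV: "D V y v = real CARD('m) *\<^sub>R (Der H y v *\<^sub>R \<nu> y + H y *\<^sub>R D \<nu> y v)" if "y \<in> S" for y v
    unfolding V_def D_cmul[OF that sH\<nu>] D_scale[OF that smooth_H smooth_\<nu>] ..
  have s1: "smooth_on S (\<lambda>y. Der H y v *\<^sub>R \<nu> y)" "smooth_on S (\<lambda>y. H y *\<^sub>R D \<nu> y v)" for v
    by (intro smooth_on_scaleR open_dom smooth_on_Der smooth_H smooth_\<nu> smooth_D)+
  have DDV: "D (\<lambda>y. D V y v) x u = real CARD('m) *\<^sub>R (Der (\<lambda>y. Der H y v) x u *\<^sub>R \<nu> x + Der H x v *\<^sub>R D \<nu> x u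
      + (Der H x u *\<^sub>R D \<nu> x v + H x *\<^sub>R D (\<lambda>y. D \<nu> y v) x u))" for u v
  proof -
    have "D (\<lambda>y. D V y v) x u = D (\<lambda>y. real CARD('m) *\<^sub>R (Der H y v *\<^sub>R \<nu> y + H y *\<^sub>R D \<nu> y v)) x u"
      by (rule D_cong[OF x]) (rule DV)
    also have "\<dots> = real CARD('m) *\<^sub>R (D (\<lambda>y. Der H y v *\<^sub>R \<nu> y) x u + D (\<lambda>y. H y *\<^sub>R D \<nu> y v) x u)"
      by (simp add: D_cmul[OF x smooth_on_add[OF open_dom s1]] D_add[OF x s1])
    also have "D (\<lambda>y. Der H y v *\<^sub>R \<nu> y) x u = Der (\<lambda>y. Der H y v) x u *\<^sub>R \<nu> x + Der H x v *\<^sub>R D \<nu> x u"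
      by (rule D_scale[OF x smooth_on_Der[OF smooth_H] smooth_\<nu>])
    also have "D (\<lambda>y. H y *\<^sub>R D \<nu> y v) x u = Der H x u *\<^sub>R D \<nu> x v + H x *\<^sub>R D (\<lambda>y. D \<nu> y v) x u"
      by (rule D_scale[OF x smooth_H smooth_D[OF smooth_\<nu>]])
    finally show ?thesis .
  qed
  have two: "(2 * a) *\<^sub>R w = a *\<^sub>R w + a *\<^sub>R w" for a and w :: "real ^ 'n"
    by (simp flip: scaleR_add_left)
  define Q where "Q = (\<lambda>u v. D (\<lambda>y. D V y v) x u - D V x (christoffel g x u v))"
  define R where "R = (\<lambda>u v. curvature h (F x) (Der F x u) (V x) (Der F x v))"
  have Q: "trace_g g x Q = (\<Sum>i\<in>UNIV. Q (e i) (e i))"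
    unfolding Q_def
    by (intro M.frame_trace_g[OF x e] linear_compose_sub linear_D[OF x] smooth_D sV
        linear_D_of_linear[OF x] linear_compose[OF linear_christoffel1 linear_D[OF x sV], unfolded o_def]
        linear_compose[OF linear_christoffel2 linear_D[OF x sV], unfolded o_def] linear_D)
  note lc = linear_curvature[OF F_in[OF x]]
  have R: "trace_g g x R = (\<Sum>i\<in>UNIV. R (e i) (e i))"
    unfolding R_def
    by (intro M.frame_trace_g[OF x e] linear_compose[OF linear_DF[OF x] lc(1), unfolded o_def]
        linear_compose[OF linear_DF[OF x] lc(3), unfolded o_def])
  have QR: "Q u u - R u u = real CARD('m) *\<^sub>R ((Der (\<lambda>y. Der H y u) x u - Der H x (christoffel g x u u)) *\<^sub>R \<nu> x
      + (2 * Der H x u) *\<^sub>R D \<nu> x u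
      + H x *\<^sub>R (D (\<lambda>y. D \<nu> y u) x u - D \<nu> x (christoffel g x u u))
      - H x *\<^sub>R curvature h (F x) (Der F x u) (\<nu> x) (Der F x u))" for u
    unfolding Q_def R_def DDV DV[OF x] Vx linear_scale[OF lc(2)] two by (simp add: algebra_simps)
  have "bitension g h F x = trace_g g x Q - trace_g g x R"
    unfolding bitension_def Q_def R_def tau2 tau[OF x] M.nabla_const by (simp add: tension_eq[OF x] V_def)
  also have "\<dots> = (\<Sum>i\<in>UNIV. Q (e i) (e i) - R (e i) (e i))"
    by (simp add: Q R sum_subtractf)
  finally show ?thesis unfolding QR scaleR_sum_right[symmetric] .
qed

lemma bitension_normal:
  assumes x: "x \<in> S"
  shows "ipF x (bitension g h F x) (\<nu> x)
    = real CARD('m) * (laplacian g H x - H x * shape_norm_sq g h F \<nu> x + H x * ricci h (F x) (\<nu> x) (\<nu> x))"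
proof -
  \<comment> \<open>The very frame chosen in \<open>shape_norm_sq\<close>, so that its definition
    unfolds literally.\<close>
  define e where "e = (SOME e. orthonormal_frame g x e)"
  have e: "orthonormal_frame g x e"
    unfolding e_def using M.orthonormal_frame_exists[OF x] by (rule someI_ex)
  let ?R = "curvature h (F x)"
  have norm: "(\<Sum>i\<in>UNIV. ip g x (A x (e i)) (A x (e i))) = shape_norm_sq g h F \<nu> x"
  proof -
    have "ip g x w w = (\<Sum>j\<in>UNIV. (ip g x w (e j))\<^sup>2)" for w
      using arg_cong[OF M.frame_expand[OF x e, of w], of "ip g x w"] by (simp add: power2_eq_square)
    then show ?thesis unfolding shape_norm_sq_def Let_def e_def[symmetric] by simp
  qed
  \<comment> \<open>Exchanging the last two slots produces the sign; the summand of the Ricci trace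
    that belongs to the normal vanishes, having equal first slots.\<close>
  have ric: "(\<Sum>i\<in>UNIV. ipF x (?R (Der F x (e i)) (\<nu> x) (Der F x (e i))) (\<nu> x)) = - ricci h (F x) (\<nu> x) (\<nu> x)"
    unfolding ricci_frame[OF x e]
    by (subst curvature_skew34[OF F_in[OF x]]) (simp add: sum_negf curvature_self[OF F_in[OF x]])
  have second: "ipF x (D (\<lambda>y. D \<nu> y v) x u) (\<nu> x) = - ip g x (A x u) (A x v)" for u v
    using second_D_\<nu>_normal[OF x, of v u] by (simp add: D_\<nu>_normal[OF x])
  have "ipF x (bitension g h F x) (\<nu> x) = real CARD('m) * (\<Sum>i\<in>UNIV.
      (Der (\<lambda>y. Der H y (e i)) x (e i) - Der H x (christoffel g x (e i) (e i)))
      - H x * ip g x (A x (e i)) (A x (e i)) - H x * ipF x (?R (Der F x (e i)) (\<nu> x) (Der F x (e i))) (\<nu> x))"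
    unfolding bitension_frame[OF x e]
    by (simp add: unit[OF x] D_\<nu>_normal[OF x] second)
  also have "\<dots> = real CARD('m) * (laplacian g H x - H x * shape_norm_sq g h F \<nu> x + H x * ricci h (F x) (\<nu> x) (\<nu> x))"
    by (simp add: sum.distrib sum_subtractf M.laplacian_frame[OF x smooth_H e] norm[symmetric] sum_distrib_left[symmetric] ric)
  finally show ?thesis .
qed

lemma bitension_tangential:
  assumes x: "x \<in> S"
  shows "ipF x (bitension g h F x) (Der F x w)
    = - real CARD('m) * (2 * ip g x (A x (grad g H x)) w + real CARD('m) * H x * Der H x w - 2 * H x * ricci h (F x) (\<nu> x) (Der F x w))"
proof -
  obtain e where e: "orthonormal_frame g x e" using M.orthonormal_frame_exists[OF x] by blast
  let ?R = "curvature h (F x)"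
  note Fx = F_in[OF x]
  have grad: "(\<Sum>i\<in>UNIV. Der H x (e i) * b x (e i) w) = ip g x (A x (grad g H x)) w"
  proof -
    have "grad g H x = (\<Sum>i\<in>UNIV. Der H x (e i) *\<^sub>R e i)"
      using M.frame_expand[OF x e, of "grad g H x"] by (simp add: M.ip_grad[OF x diff[OF smooth_H x]])
    then show ?thesis
      by (simp add: linear_sum[OF linear_A[OF x]] linear_scale[OF linear_A[OF x]] ip_A[OF x])
  qed
  \<comment> \<open>Codazzi moves \<open>w\<close> to the first slot of \<open>Db\<close>, where the
    trace is the derivative of m \<open>H\<close>; the curvature picked up on the way sums to a
    Ricci term.\<close>
  have cod: "(\<Sum>i\<in>UNIV. Db x (e i) (e i) w) = real CARD('m) * Der H x w - ricci h (F x) (\<nu> x) (Der F x w)"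
  proof -
    have "Db x u u w = Db x w u u - ipF x (?R (Der F x u) (Der F x w) (\<nu> x)) (Der F x u)" for u
      using codazzi[OF x, of u w u] Db_sym[OF x, of u u w] curvature_skew34[OF Fx, of _ _ "Der F x u" "\<nu> x"] by simp
    moreover have "(\<Sum>i\<in>UNIV. ipF x (?R (Der F x (e i)) (Der F x w) (\<nu> x)) (Der F x (e i))) = ricci h (F x) (Der F x w) (\<nu> x)"
      unfolding ricci_frame[OF x e] using curvature_skew34[OF Fx, of "\<nu> x" "Der F x w" "\<nu> x" "\<nu> x"] by simp
    ultimately show ?thesis
      by (simp add: sum_subtractf trace_Db[OF x e] ricci_sym[OF Fx, of "\<nu> x"])
  qed
  have ric: "(\<Sum>i\<in>UNIV. ipF x (?R (Der F x (e i)) (\<nu> x) (Der F x (e i))) (Der F x w)) = - ricci h (F x) (\<nu> x) (Der F x w)"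
    unfolding ricci_frame[OF x e]
    by (subst curvature_skew34[OF Fx]) (simp add: sum_negf curvature_self[OF Fx])
  have second: "ipF x (D (\<lambda>y. D \<nu> y v) x u) (Der F x w) = - Db x u v w - b x (christoffel g x u v) w" for u v
    using second_D_\<nu>_tangential[OF x, of v u w] by (simp add: D_\<nu>_tangential[OF x])
  have "ipF x (bitension g h F x) (Der F x w) = real CARD('m) * (\<Sum>i\<in>UNIV.
      - 2 * (Der H x (e i) * b x (e i) w) - H x * Db x (e i) (e i) w
      - H x * ipF x (?R (Der F x (e i)) (\<nu> x) (Der F x (e i))) (Der F x w))"
    unfolding bitension_frame[OF x e]
    by (auto simp: normal[OF x] D_\<nu>_tangential[OF x] second algebra_simps intro!: sum.cong)
  also have "\<dots> = real CARD('m) * (- 2 * ip g x (A x (grad g H x)) w - H x * (real CARD('m) * Der H x w - ricci h (F x) (\<nu> x) (Der F x w))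
      + H x * ricci h (F x) (\<nu> x) (Der F x w))"
    by (simp only: sum_subtractf sum_distrib_left[symmetric] grad cod ric) simp
  finally show ?thesis by (simp add: algebra_simps)
qed

text \<open>The decomposition of \<open>W\<close> provides the vector that the definite description
  in \<open>tangential\<close> asks for, and nondegeneracy of \<open>g\<close> its
  uniqueness.\<close>

lemma ip_tangential:
  assumes x: "x \<in> S"
  shows "ip g x (tangential h F x W) v = ipF x W (Der F x v)"
proof -
  obtain a s where W: "W = Der F x a + s *\<^sub>R \<nu> x" using tangent_normal_decomp[OF x] by blast
  have "tangential h F x W = a"
    unfolding tangential_def
  proof (rule the_equality)
    show "\<forall>v. ipF x (W - Der F x a) (Der F x v) = 0" by (simp add: W normal[OF x])
    fix w assume "\<forall>v. ipF x (W - Der F x w) (Der F x v) = 0"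
    then have "ip g x w v = ip g x a v" for v by (simp add: W normal[OF x] isometric[OF x])
    then show "w = a" by (rule M.ip_eqI[OF x])
  qed
  then show ?thesis by (simp add: W normal[OF x] isometric[OF x])
qed

text \<open>A vector vanishes exactly when its pairings with the normal and with all tangent vectors
  do; the factor m in both pairings is positive, being the cardinality of a finite type.\<close>

theorem bitension_zero_iff:
  assumes x: "x \<in> S"
  shows "bitension g h F x = 0 \<longleftrightarrow> hypersurface_equations g h F \<nu> x"
proof -
  define Z where "Z = 2 *\<^sub>R A x (grad g H x) + (real CARD('m) / 2) *\<^sub>R grad g (\<lambda>y. (H y)\<^sup>2) x
          - (2 * H x) *\<^sub>R tangential h F x (ricci_op h (F x) (\<nu> x))"
  \<comment> \<open>The tangential component contains m \<open>H\<close> times the gradient of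
    \<open>H\<close>, which the second equation writes as m/2 times the gradient of
    \<open>H\<^sup>2\<close>.\<close>
  have dH2: "((\<lambda>y. (H y)\<^sup>2) has_derivative (\<lambda>w. 2 * H x * Der H x w)) (at x)"
    using has_derivative_power[OF differentiable_has_Der[OF diff[OF smooth_H x]], of 2]
    by (simp add: mult_ac)
  have "ip g x (grad g (\<lambda>y. (H y)\<^sup>2) x) w = 2 * H x * Der H x w" for w
    using M.ip_grad[OF x, of "\<lambda>y. (H y)\<^sup>2"] dH2 Der_eqI[OF dH2] by (auto simp: differentiable_def)
  then have "ip g x Z w = 2 * ip g x (A x (grad g H x)) w + real CARD('m) * H x * Der H x w - 2 * H x * ricci h (F x) (\<nu> x) (Der F x w)" for w
    by (simp add: Z_def ip_tangential[OF x] ip_ricci_op[OF F_in[OF x]])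
  then have tan: "ipF x (bitension g h F x) (Der F x w) = - real CARD('m) * ip g x Z w" for w
    unfolding bitension_tangential[OF x] by simp
  have "(\<forall>w. ip g x Z w = 0) \<longleftrightarrow> Z = 0"
    using M.ip_eqI[OF x, of Z 0] by auto
  then show ?thesis
    unfolding zero_iff_components[OF x] bitension_normal[OF x] tan hypersurface_equations_def Let_def Z_def[symmetric]
    by simp
qed

end

section \<open>Local unit normal fields\<close>

context isometric_codim1
begin

lemma local_unit_normal:
  assumes x0: "x0 \<in> S"
  shows "\<exists>U \<nu>. open U \<and> x0 \<in> U \<and> U \<subseteq> S \<and> smooth_on U \<nu> \<and>
    (\<forall>x\<in>U. ip h (F x) (\<nu> x) (\<nu> x) = 1 \<and> (\<forall>v. ip h (F x) (\<nu> x) (Der F x v) = 0))"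
proof -
  have "dim (range (Der F x0)) \<le> CARD('m)"
    using dim_image_le[OF linear_DF[OF x0], of UNIV] by simp
  then have "range (Der F x0) \<noteq> UNIV" using codim1 by auto
  then obtain a where a: "a \<notin> range (Der F x0)" by blast
  \<comment> \<open>The tangential part of \<open>a\<close>, obtained by duality from the metric
    alone; as a \<open>sharp\<close> it depends smoothly on the point.\<close>
  define t where "t = (\<lambda>y. sharp g y (\<lambda>v. ipF y a (Der F y v)))"
  have lin: "linear (\<lambda>v. ipF y a (Der F y v))" if "y \<in> S" for y
    by (rule linear_compose[OF linear_DF[OF that] linear_ip2, unfolded o_def])
  have t: "ip g y (t y) v = ipF y a (Der F y v)" if "y \<in> S" for y v
    unfolding t_def by (rule M.ip_sharp[OF that lin[OF that]])
  have st: "smooth_on S t"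
    unfolding t_def
    by (rule M.smooth_sharp) (auto intro: open_dom lin smooth_ip smooth_on_const smooth_DF)
  define V where "V = (\<lambda>y. a - Der F y (t y))"
  have sV: "smooth_on S V"
    unfolding V_def
    by (rule smooth_on_diff[OF open_dom smooth_on_const
          smooth_on_linear_family[OF open_dom smooth_DF linear_DF st]])
  have Vn: "ipF y (V y) (Der F y v) = 0" if "y \<in> S" for y v
    by (simp add: V_def isometric[OF that] t[OF that])
  define q where "q = (\<lambda>y. ipF y (V y) (V y))"
  have sq: "smooth_on S q" unfolding q_def by (rule smooth_ip[OF sV sV])
  define U where "U = S \<inter> q -` {0<..}"
  have U: "open U" "U \<subseteq> S"
    unfolding U_def using continuous_open_preimage[OF smooth_on_continuous[OF sq] open_dom] by auto
  have "V x0 \<noteq> 0" using a unfolding V_def by auto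
  then have "x0 \<in> U" using x0 ip_pos[OF F_in[OF x0]] by (simp add: U_def q_def)
  define \<nu> where "\<nu> = (\<lambda>y. inverse (sqrt (q y)) *\<^sub>R V y)"
  have qpos: "q y > 0" if "y \<in> U" for y using that by (simp add: U_def)
  have "smooth_on U \<nu>"
    unfolding \<nu>_def
    by (intro smooth_on_scaleR smooth_on_inverse smooth_on_sqrt U smooth_on_subset[OF sq] smooth_on_subset[OF sV])
      (auto dest: qpos)
  moreover have "ipF y (\<nu> y) (\<nu> y) = 1" if "y \<in> U" for y
  proof -
    have "ipF y (V y) (V y) = q y" by (simp add: q_def)
    then show ?thesis using qpos[OF that] by (simp add: \<nu>_def field_simps)
  qed
  moreover have "ipF y (\<nu> y) (Der F y v) = 0" if "y \<in> U" for y v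
    using Vn[of y v] that U(2) by (auto simp: \<nu>_def)
  ultimately show ?thesis using U \<open>x0 \<in> U\<close> by blast
qed

end

section \<open>Charts\<close>

text \<open>The factorization is assumed only on an open set around \<open>x\<close>, because
  coordinate representations compose only on overlaps of charts.\<close>

lemma Der_chain:
  assumes "open S" "x \<in> S" "\<And>y. y \<in> S \<Longrightarrow> f y = k (l y)"
    and "l differentiable (at x)" "k differentiable (at (l x))"
  shows "Der f x v = Der k (l x) (Der l x v)"
proof -
  have "Der f x = Der (\<lambda>y. k (l y)) x" by (rule Der_cong_open[OF assms(1,2)]) (rule assms(3))
  then show ?thesis
    using fun_cong[OF Der_eqI[OF has_derivative_compose[OF differentiable_has_Der[OF assms(4)] differentiable_has_Der[OF assms(5)]]]]
    by simp
qed

lemma chart_inv_coord: "is_chart c \<Longrightarrow> p \<in> cdom c \<Longrightarrow> chart_inv c (coord c p) = p"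
  unfolding is_chart_def homeomorphism_def by blast

lemma open_coord_image:
  assumes c: "is_chart c" and W: "open W" "W \<subseteq> cdom c"
  shows "open (coord c ` W)"
proof -
  have "openin (top_of_set (cdom c)) W"
    using W by (simp add: openin_open_eq c[unfolded is_chart_def])
  then have "openin (top_of_set (coord c ` cdom c)) (coord c ` W)"
    using c homeomorphism_imp_open_map unfolding is_chart_def by blast
  then show ?thesis using c by (simp add: openin_open_eq is_chart_def)
qed

lemma open_chart_inv_image:
  assumes c: "is_chart c" and W: "open W" "W \<subseteq> coord c ` cdom c"
  shows "open (chart_inv c ` W)"
proof -
  have "homeomorphism (coord c ` cdom c) (cdom c) (chart_inv c) (coord c)"
    using c homeomorphism_symD unfolding is_chart_def by blast
  moreover have "openin (top_of_set (coord c ` cdom c)) W"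
    using W c by (simp add: openin_open_eq is_chart_def)
  ultimately have "openin (top_of_set (cdom c)) (chart_inv c ` W)"
    using homeomorphism_imp_open_map by blast
  then show ?thesis using c by (simp add: openin_open_eq is_chart_def)
qed

lemma riemannian_manifoldD:
  assumes "riemannian_manifold M"
  shows "\<exists>c. c \<in> atlas M \<and> p \<in> cdom c"
    and "c \<in> atlas M \<Longrightarrow> is_chart c"
    and "c \<in> atlas M \<Longrightarrow> c' \<in> atlas M \<Longrightarrow> smooth_on (coord c ` (cdom c \<inter> cdom c')) (transition c c')"
    and "c \<in> atlas M \<Longrightarrow> smooth_on (coord c ` cdom c) (metric M c)"
    and "c \<in> atlas M \<Longrightarrow> p \<in> cdom c \<Longrightarrow>
      ip (metric M c) (coord c p) u v = ip (metric M c) (coord c p) v u"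
    and "c \<in> atlas M \<Longrightarrow> p \<in> cdom c \<Longrightarrow> u \<noteq> 0 \<Longrightarrow> ip (metric M c) (coord c p) u u > 0"
    and "c \<in> atlas M \<Longrightarrow> p \<in> cdom c \<Longrightarrow> c' \<in> atlas M \<Longrightarrow> p \<in> cdom c' \<Longrightarrow>
      ip (metric M c') (coord c' p) (Der (transition c c') (coord c p) u) (Der (transition c c') (coord c p) v)
      = ip (metric M c) (coord c p) u v"
proof -
  note rm = assms[unfolded riemannian_manifold_def]
  note atlas = conjunct1[OF rm] and smooth = bspec[OF conjunct1[OF conjunct2[OF rm]]]
    and met = bspec[OF spec[OF conjunct2[OF conjunct2[OF rm]]]]
  show "\<exists>c. c \<in> atlas M \<and> p \<in> cdom c"
    using atlas UNIV_I[of p] unfolding smooth_atlas_def by blast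
  show "c \<in> atlas M \<Longrightarrow> is_chart c"
    "c \<in> atlas M \<Longrightarrow> c' \<in> atlas M \<Longrightarrow> smooth_on (coord c ` (cdom c \<inter> cdom c')) (transition c c')"
    using atlas unfolding smooth_atlas_def by simp_all
  show "c \<in> atlas M \<Longrightarrow> smooth_on (coord c ` cdom c) (metric M c)" by (rule smooth)
  assume c: "c \<in> atlas M" "p \<in> cdom c"
  then have ch: "c \<in> charts_at M p" by (simp add: charts_at_def)
  show "ip (metric M c) (coord c p) u v = ip (metric M c) (coord c p) v u"
    using conjunct1[OF met[OF ch]] by blast
  show "u \<noteq> 0 \<Longrightarrow> ip (metric M c) (coord c p) u u > 0"
    using conjunct1[OF conjunct2[OF met[OF ch]]] by blast
  assume "c' \<in> atlas M" "p \<in> cdom c'"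
  then have "c' \<in> charts_at M p" by (simp add: charts_at_def)
  from bspec[OF conjunct2[OF conjunct2[OF met[OF ch]]] this]
  show "ip (metric M c') (coord c' p) (Der (transition c c') (coord c p) u) (Der (transition c c') (coord c p) v)
      = ip (metric M c) (coord c p) u v"
    by simp
qed

text \<open>Stated for open parts \<open>X\<close> of the chart image, since an immersion is
  represented only at points that lie in the domain of the normal and are mapped into the target
  chart.\<close>

lemma metric_on_chart:
  assumes M: "riemannian_manifold M" and c: "c \<in> atlas M" and X: "open X" "X \<subseteq> coord c ` cdom c"
  shows "metric_on (metric M c) X"
proof
  show "smooth_on X (metric M c)"
    by (rule smooth_on_subset[OF riemannian_manifoldD(4)[OF M c] X(2)])
  fix x assume "x \<in> X"
  then obtain p where p: "x = coord c p" "p \<in> cdom c" using X(2) by auto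
  show "ip (metric M c) x u v = ip (metric M c) x v u" for u v
    unfolding p(1) by (rule riemannian_manifoldD(5)[OF M c p(2)])
  show "0 < ip (metric M c) x u u" if "u \<noteq> 0" for u
    unfolding p(1) by (rule riemannian_manifoldD(6)[OF M c p(2) that])
qed (rule X)

section \<open>Codimension-one immersions of manifolds, read in charts\<close>

locale codim1_immersion =
  fixes M :: "('a::{t2_space, second_countable_topology}, 'm::finite) rmanifold"
    and N :: "('b::{t2_space, second_countable_topology}, 'n::finite) rmanifold"
    and \<phi> :: "'a \<Rightarrow> 'b"
  assumes M: "riemannian_manifold M" and N: "riemannian_manifold N"
    and codim1: "CARD('n) = CARD('m) + 1"
    and immersion: "isometric_immersion M N \<phi>"
begin

lemmas chart_M = riemannian_manifoldD(2)[OF M]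
lemmas chart_N = riemannian_manifoldD(2)[OF N]
lemmas smooth_transition_M = riemannian_manifoldD(3)[OF M]
lemmas smooth_transition_N = riemannian_manifoldD(3)[OF N]

lemma open_coord_cdom: "d \<in> atlas N \<Longrightarrow> open (coord d ` cdom d)"
  using chart_N[of d] by (simp add: is_chart_def)

lemma open_preimage:
  assumes "d \<in> atlas N"
  shows "open (\<phi> -` cdom d)"
  using immersion chart_N[OF assms]
  by (auto simp: isometric_immersion_def smooth_map_def is_chart_def intro: open_vimage)

lemma open_coord_dom:
  assumes "c \<in> atlas M" "d \<in> atlas N" "open U"
  shows "open (coord c ` (U \<inter> cdom c \<inter> \<phi> -` cdom d))"
  using chart_M[OF assms(1)] open_preimage[OF assms(2)] assms(3)
  by (intro open_coord_image) (auto simp: is_chart_def)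

lemma smooth_local_rep:
  assumes "c \<in> atlas M" "d \<in> atlas N"
  shows "smooth_on (coord c ` (cdom c \<inter> \<phi> -` cdom d)) (local_rep \<phi> c d)"
  using immersion assms by (simp add: isometric_immersion_def smooth_map_def)

lemma isometric:
  assumes "c \<in> atlas M" "d \<in> atlas N" "p \<in> cdom c" "\<phi> p \<in> cdom d"
  shows "ip (metric N d) (coord d (\<phi> p)) (Der (local_rep \<phi> c d) (coord c p) u) (Der (local_rep \<phi> c d) (coord c p) v)
    = ip (metric M c) (coord c p) u v"
proof -
  have "c \<in> charts_at M p" "d \<in> charts_at N (\<phi> p)" using assms by (auto simp: charts_at_def)
  then show ?thesis using immersion unfolding isometric_immersion_def by blast
qed

text \<open>\<open>U\<close> is meant as the domain of a normal field; with \<open>U\<close> the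
  whole manifold the lemma enters the construction of such a field.\<close>

lemma isometric_codim1_charts:
  assumes c: "c \<in> atlas M" and d: "d \<in> atlas N" and U: "open U"
  shows "isometric_codim1 (metric N d) (coord d ` cdom d) (local_rep \<phi> c d)
    (coord c ` (U \<inter> cdom c \<inter> \<phi> -` cdom d)) (metric M c)" (is "isometric_codim1 ?h ?T ?F ?X ?g")
proof -
  have X: "open ?X" by (rule open_coord_dom[OF c d U])
  interpret N: metric_on ?h ?T by (rule metric_on_chart[OF N d open_coord_cdom[OF d] subset_refl])
  interpret M: metric_on ?g ?X by (rule metric_on_chart[OF M c X]) auto
  show ?thesis
  proof
    show "smooth_on ?X ?F" by (rule smooth_on_subset[OF smooth_local_rep[OF c d]]) auto
    show "?F x \<in> ?T" if "x \<in> ?X" for x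
      using that chart_inv_coord[OF chart_M[OF c]] by (auto simp: local_rep_def)
    show "ip ?h (?F x) (Der ?F x u) (Der ?F x v) = ip ?g x u v" if x: "x \<in> ?X" for x u v
    proof -
      obtain p where p: "x = coord c p" "p \<in> cdom c" "\<phi> p \<in> cdom d" using x by auto
      then have "?F x = coord d (\<phi> p)"
        using chart_inv_coord[OF chart_M[OF c]] by (simp add: local_rep_def)
      then show ?thesis
        using isometric[OF c d p(2,3)] p(1) by simp
    qed
  qed (rule X codim1)+
qed

lemma hypersurface_charts:
  assumes c: "c \<in> atlas M" and d: "d \<in> atlas N" and \<xi>: "unit_normal_on M N \<phi> U \<xi>"
  shows "hypersurface (metric N d) (coord d ` cdom d) (local_rep \<phi> c d)
    (coord c ` (U \<inter> cdom c \<inter> \<phi> -` cdom d)) (metric M c) (\<xi> d \<circ> chart_inv c)"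
    (is "hypersurface ?h ?T ?F ?X ?g ?\<nu>")
proof -
  have U: "open U" using \<xi> by (simp add: unit_normal_on_def)
  interpret isometric_codim1 ?h ?T ?F ?X ?g by (rule isometric_codim1_charts[OF c d U])
  show ?thesis
  proof
    show "smooth_on ?X ?\<nu>" using \<xi> c d by (simp add: unit_normal_on_def)
    fix x assume "x \<in> ?X"
    then obtain p where p: "x = coord c p" "p \<in> U" "p \<in> cdom c" "\<phi> p \<in> cdom d" by auto
    then have ch: "c \<in> charts_at M p" "d \<in> charts_at N (\<phi> p)" using c d by (auto simp: charts_at_def)
    from p have e: "?F x = coord d (\<phi> p)" "?\<nu> x = \<xi> d p"
      using chart_inv_coord[OF chart_M[OF c]] by (simp_all add: local_rep_def)
    have "ip ?h (coord d (\<phi> p)) (\<xi> d p) (\<xi> d p) = 1 \<and>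
        (\<forall>c\<in>charts_at M p. \<forall>v. ip ?h (coord d (\<phi> p)) (\<xi> d p) (Der (local_rep \<phi> c d) (coord c p) v) = 0)"
      using \<xi> p(2) ch(2) unfolding unit_normal_on_def by blast
    then show "ip ?h (?F x) (?\<nu> x) (?\<nu> x) = 1" "ip ?h (?F x) (?\<nu> x) (Der ?F x v) = 0" for v
      unfolding e using ch(1) p(1) by auto
  qed
qed

lemma bitension_zero_iff_charts:
  assumes \<xi>: "unit_normal_on M N \<phi> U \<xi>" and p: "p \<in> U" "c \<in> charts_at M p" "d \<in> charts_at N (\<phi> p)"
  shows "bitension (metric M c) (metric N d) (local_rep \<phi> c d) (coord c p) = 0 \<longleftrightarrow>
    hypersurface_equations (metric M c) (metric N d) (local_rep \<phi> c d) (\<xi> d \<circ> chart_inv c) (coord c p)"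
  using p by (intro hypersurface.bitension_zero_iff[OF hypersurface_charts[OF _ _ \<xi>]])
    (auto simp: charts_at_def)

text \<open>A unit normal field is found in one pair of charts \<open>c0\<close>, \<open>d0\<close> and transported to the
  other charts of \<open>N\<close> by the differentials of the transition maps.\<close>

lemma unit_normal_exists: "\<exists>U \<xi>. p \<in> U \<and> unit_normal_on M N \<phi> U \<xi>"
proof -
  obtain c0 where c0: "c0 \<in> atlas M" "p \<in> cdom c0"
    using riemannian_manifoldD(1)[OF M] by blast
  obtain d0 where d0: "d0 \<in> atlas N" "\<phi> p \<in> cdom d0"
    using riemannian_manifoldD(1)[OF N] by blast
  let ?F0 = "local_rep \<phi> c0 d0"
  let ?X0 = "coord c0 ` (UNIV \<inter> cdom c0 \<inter> \<phi> -` cdom d0)"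
  interpret L: isometric_codim1 "metric N d0" "coord d0 ` cdom d0" ?F0 ?X0 "metric M c0"
    by (rule isometric_codim1_charts[OF c0(1) d0(1) open_UNIV])
  obtain X \<nu> where X: "open X" "coord c0 p \<in> X" "X \<subseteq> ?X0" and s\<nu>: "smooth_on X \<nu>"
    and unit: "\<And>x. x \<in> X \<Longrightarrow> ip (metric N d0) (?F0 x) (\<nu> x) (\<nu> x) = 1"
    and normal: "\<And>x v. x \<in> X \<Longrightarrow> ip (metric N d0) (?F0 x) (\<nu> x) (Der ?F0 x v) = 0"
    using L.local_unit_normal[of "coord c0 p"] c0 d0 by blast
  define U where "U = chart_inv c0 ` X"
  define \<xi> where "\<xi> = (\<lambda>d q. Der (transition d0 d) (coord d0 (\<phi> q)) (\<nu> (coord c0 q)))"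
  note inv = chart_inv_coord[OF chart_M] chart_inv_coord[OF chart_N]
  have U: "q \<in> cdom c0 \<and> \<phi> q \<in> cdom d0 \<and> coord c0 q \<in> X" if "q \<in> U" for q
    using that X(3) inv(1)[OF c0(1)] unfolding U_def by fastforce
  have openU: "open U"
    unfolding U_def using X by (intro open_chart_inv_image chart_M c0) auto
  have pU: "p \<in> U"
    unfolding U_def using inv(1)[OF c0] X(2) by (metis imageI)
  have dtr: "transition d d' differentiable (at (coord d r))"
    if "d \<in> atlas N" "d' \<in> atlas N" "r \<in> cdom d" "r \<in> cdom d'" for d d' r
    using that chart_N[of d] chart_N[of d']
    by (intro smooth_on_differentiable[OF smooth_transition_N] open_coord_image) (auto simp: is_chart_def)
  have "unit_normal_on M N \<phi> U \<xi>"
    unfolding unit_normal_on_def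
  proof (intro conjI ballI allI)
    show "open U" by (rule openU)
  next
    fix c d assume c: "c \<in> atlas M" and d: "d \<in> atlas N"
    let ?Y = "coord c ` (U \<inter> cdom c \<inter> \<phi> -` cdom d)"
    let ?Z = "coord d0 ` (cdom d0 \<inter> cdom d)"
    have Y: "open ?Y" by (rule open_coord_dom[OF c d openU])
    have Z: "open ?Z"
      using chart_N[OF d0(1)] chart_N[OF d] by (intro open_coord_image) (auto simp: is_chart_def)
    have F: "smooth_on ?Y (local_rep \<phi> c d0)" "local_rep \<phi> c d0 ` ?Y \<subseteq> ?Z"
      using U inv(1)[OF c] smooth_on_subset[OF smooth_local_rep[OF c d0(1)], of ?Y]
      by (auto simp: local_rep_def)
    have tr: "smooth_on ?Y (transition c c0)" "transition c c0 ` ?Y \<subseteq> X"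
      using U inv(1)[OF c] smooth_on_subset[OF smooth_transition_M[OF c c0(1)], of ?Y] by auto
    have s1: "smooth_on ?Y (\<lambda>y. Der (transition d0 d) (local_rep \<phi> c d0 y) v)" for v
      by (rule smooth_on_compose[OF Y Z F(2) smooth_on_Der[OF smooth_transition_N[OF d0(1) d]] F(1)])
    have s2: "linear (Der (transition d0 d) (local_rep \<phi> c d0 y))" if "y \<in> ?Y" for y
      using smooth_on_linear_Der[OF smooth_transition_N[OF d0(1) d] Z] F(2) that by blast
    have s3: "smooth_on ?Y (\<lambda>y. \<nu> (transition c c0 y))"
      by (rule smooth_on_compose[OF Y X(1) tr(2) s\<nu> tr(1)])
    have "smooth_on ?Y (\<lambda>y. Der (transition d0 d) (local_rep \<phi> c d0 y) (\<nu> (transition c c0 y)))"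
      by (rule smooth_on_linear_family[OF Y s1 s2 s3])
    then show "smooth_on ?Y (\<xi> d \<circ> chart_inv c)"
      by (simp add: \<xi>_def local_rep_def o_def)
  next
    fix q d d' assume q: "q \<in> U" and "d \<in> charts_at N (\<phi> q)" "d' \<in> charts_at N (\<phi> q)"
    then have d: "d \<in> atlas N" "\<phi> q \<in> cdom d" and d': "d' \<in> atlas N" "\<phi> q \<in> cdom d'"
      by (auto simp: charts_at_def)
    \<comment> \<open>Transition maps compose on the triple overlap, so the transformation law of
      \<xi> is the chain rule.\<close>
    let ?W = "coord d0 ` (cdom d0 \<inter> cdom d \<inter> cdom d')"
    have W: "open ?W"
      using chart_N[OF d0(1)] chart_N[OF d(1)] chart_N[OF d'(1)]
      by (intro open_coord_image) (auto simp: is_chart_def)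
    have "transition d0 d' y = transition d d' (transition d0 d y)" if "y \<in> ?W" for y
      using that inv(2)[OF d0(1)] inv(2)[OF d(1)] by auto
    moreover have "transition d0 d (coord d0 (\<phi> q)) = coord d (\<phi> q)"
      using inv(2)[OF d0(1)] U[OF q] by simp
    ultimately show "\<xi> d' q = Der (transition d d') (coord d (\<phi> q)) (\<xi> d q)"
      using Der_chain[OF W, of "coord d0 (\<phi> q)" "transition d0 d'" "transition d d'" "transition d0 d"]
        dtr[OF d0(1) d(1), of "\<phi> q"] dtr[OF d(1) d'(1), of "\<phi> q"] U[OF q] d d'
      unfolding \<xi>_def by simp
  next
    fix q d assume q: "q \<in> U" and "d \<in> charts_at N (\<phi> q)"
    then have d: "d \<in> atlas N" "\<phi> q \<in> cdom d" by (auto simp: charts_at_def)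
    \<comment> \<open>Differentials of transition maps are isometries for the coordinate metrics, so
      unit length and orthogonality pass from \<open>d0\<close> to \<open>d\<close>.\<close>
    have inv_met: "ip (metric N d) (coord d (\<phi> q)) (Der (transition d0 d) (coord d0 (\<phi> q)) u) (Der (transition d0 d) (coord d0 (\<phi> q)) v)
        = ip (metric N d0) (coord d0 (\<phi> q)) u v" for u v
      using riemannian_manifoldD(7)[OF N d0(1) _ d] U[OF q] by blast
    have F0: "?F0 (coord c0 q) = coord d0 (\<phi> q)"
      using inv(1)[OF c0(1)] U[OF q] by (simp add: local_rep_def)
    show "ip (metric N d) (coord d (\<phi> q)) (\<xi> d q) (\<xi> d q) = 1"
      unfolding \<xi>_def inv_met using unit[of "coord c0 q"] U[OF q] F0 by simp
    fix c v assume "c \<in> charts_at M q"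
    then have c: "c \<in> atlas M" "q \<in> cdom c" by (auto simp: charts_at_def)
    note qU = U[OF q]
    let ?W = "coord c ` (U \<inter> cdom c \<inter> \<phi> -` cdom d)"
    have W: "open ?W" "coord c q \<in> ?W"
      using open_coord_dom[OF c(1) d(1) openU] q c d by auto
    \<comment> \<open>The representative in \<open>c\<close> and \<open>d\<close> factors through
      the reference charts, so its differential passes through that of \<open>?F0\<close>, whose
      image is orthogonal to \<open>\<nu>\<close>.\<close>
    have e1: "local_rep \<phi> c d y = transition d0 d (local_rep \<phi> c d0 y)"
      and e2: "local_rep \<phi> c d0 y = ?F0 (transition c c0 y)" if "y \<in> ?W" for y
      using that inv(1)[OF c(1)] inv(1)[OF c0(1)] inv(2)[OF d0(1)] U by (auto simp: local_rep_def)
    have at: "local_rep \<phi> c d0 (coord c q) = coord d0 (\<phi> q)" "transition c c0 (coord c q) = coord c0 q"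
      using inv(1)[OF c(1) c(2)] by (simp_all add: local_rep_def)
    have d1: "local_rep \<phi> c d0 differentiable (at (coord c q))"
      by (rule smooth_on_differentiable[OF smooth_on_subset[OF smooth_local_rep[OF c(1) d0(1)]] W]) (use U in auto)
    have d2: "transition c c0 differentiable (at (coord c q))"
      by (rule smooth_on_differentiable[OF smooth_on_subset[OF smooth_transition_M[OF c(1) c0(1)]] W]) (use U in auto)
    have d3: "?F0 differentiable (at (coord c0 q))"
      using X(3) qU by (intro L.diff[OF L.smooth_F]) auto
    have "Der (local_rep \<phi> c d) (coord c q) v
        = Der (transition d0 d) (coord d0 (\<phi> q)) (Der (local_rep \<phi> c d0) (coord c q) v)"
      using Der_chain[where f = "local_rep \<phi> c d" and k = "transition d0 d" and l = "local_rep \<phi> c d0", OF W e1 d1]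
        dtr[OF d0(1) d(1), of "\<phi> q"] qU d(2) unfolding at(1) by blast
    also have "Der (local_rep \<phi> c d0) (coord c q) v = Der ?F0 (coord c0 q) (Der (transition c c0) (coord c q) v)"
      using Der_chain[where f = "local_rep \<phi> c d0" and k = ?F0 and l = "transition c c0", OF W e2 d2] d3
      unfolding at(2) by blast
    finally have Dv: "Der (local_rep \<phi> c d) (coord c q) v = Der (transition d0 d) (coord d0 (\<phi> q))
        (Der ?F0 (coord c0 q) (Der (transition c c0) (coord c q) v))" .
    show "ip (metric N d) (coord d (\<phi> q)) (\<xi> d q) (Der (local_rep \<phi> c d) (coord c q) v) = 0"
      unfolding \<xi>_def Dv inv_met using normal[of "coord c0 q"] qU F0 by simp
  qed
  then show ?thesis using pU by blast
qed

lemma biharmonic_imp_equations: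
  assumes "biharmonic M N \<phi>" "unit_normal_on M N \<phi> U \<xi>"
  shows "hypersurface_equations_on M N \<phi> U \<xi>"
  using assms(1) bitension_zero_iff_charts[OF assms(2)]
  unfolding biharmonic_def hypersurface_equations_on_def by blast

text \<open>The bitension field at \<open>p\<close> does not involve a normal, so a single normal
  field around \<open>p\<close> decides whether it vanishes there, in every pair of charts.\<close>

lemma equations_imp_biharmonic:
  assumes "\<And>p. \<exists>U \<xi>. p \<in> U \<and> unit_normal_on M N \<phi> U \<xi> \<and> hypersurface_equations_on M N \<phi> U \<xi>"
  shows "biharmonic M N \<phi>"
  unfolding biharmonic_def
proof (intro allI ballI)
  fix p c d assume "c \<in> charts_at M p" "d \<in> charts_at N (\<phi> p)"
  moreover obtain U \<xi> where "p \<in> U" "unit_normal_on M N \<phi> U \<xi>" "hypersurface_equations_on M N \<phi> U \<xi>"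
    using assms by blast
  ultimately show "bitension (metric M c) (metric N d) (local_rep \<phi> c d) (coord c p) = 0"
    using bitension_zero_iff_charts unfolding hypersurface_equations_on_def by blast
qed

end

theorem theorem2p1:
  fixes M :: "('a::{t2_space, second_countable_topology}, 'm::finite) rmanifold"
    and N :: "('b::{t2_space, second_countable_topology}, 'n::finite) rmanifold"
    and \<phi> :: "'a \<Rightarrow> 'b"
  assumes "riemannian_manifold M" and "riemannian_manifold N"
    and "CARD('n) = CARD('m) + 1"
    and "isometric_immersion M N \<phi>"
  shows "(biharmonic M N \<phi> \<longleftrightarrow>
            (\<forall>U \<xi>. unit_normal_on M N \<phi> U \<xi> \<longrightarrow> hypersurface_equations_on M N \<phi> U \<xi>)) \<and>
         (biharmonic M N \<phi> \<longleftrightarrow>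
            (\<forall>p. \<exists>U \<xi>. p \<in> U \<and> unit_normal_on M N \<phi> U \<xi> \<and> hypersurface_equations_on M N \<phi> U \<xi>))"
proof -
  interpret codim1_immersion M N \<phi> by (rule codim1_immersion.intro) (rule assms)+
  show ?thesis
  proof (intro conjI iffI allI impI)
    show "hypersurface_equations_on M N \<phi> U \<xi>" if "biharmonic M N \<phi>" "unit_normal_on M N \<phi> U \<xi>" for U \<xi>
      using that by (rule biharmonic_imp_equations)
    show "biharmonic M N \<phi>"
      if *: "\<forall>U \<xi>. unit_normal_on M N \<phi> U \<xi> \<longrightarrow> hypersurface_equations_on M N \<phi> U \<xi>"
    proof (rule equations_imp_biharmonic)
      fix p
      \<comment> \<open>Existence of local normals keeps the universally quantified condition from
        being vacuous near \<open>p\<close>.\<close>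
      obtain U \<xi> where "p \<in> U" "unit_normal_on M N \<phi> U \<xi>" using unit_normal_exists by blast
      moreover from * this(2) have "hypersurface_equations_on M N \<phi> U \<xi>" by blast
      ultimately show "\<exists>U \<xi>. p \<in> U \<and> unit_normal_on M N \<phi> U \<xi> \<and> hypersurface_equations_on M N \<phi> U \<xi>"
        by blast
    qed
    show "\<exists>U \<xi>. p \<in> U \<and> unit_normal_on M N \<phi> U \<xi> \<and> hypersurface_equations_on M N \<phi> U \<xi>"
      if *: "biharmonic M N \<phi>" for p
    proof -
      obtain U \<xi> where "p \<in> U" "unit_normal_on M N \<phi> U \<xi>" using unit_normal_exists by blast
      moreover from * this(2) have "hypersurface_equations_on M N \<phi> U \<xi>" by (rule biharmonic_imp_equations)
      ultimately show ?thesis by blast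
    qed
    show "biharmonic M N \<phi>"
      if "\<forall>p. \<exists>U \<xi>. p \<in> U \<and> unit_normal_on M N \<phi> U \<xi> \<and> hypersurface_equations_on M N \<phi> U \<xi>"
      using that by (intro equations_imp_biharmonic) (rule spec)
  qed
qed

end
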